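(* Let $R$ be a commutative noetherian ring with identity. Then every wide subcategory of $\mathrm{Art}(R)$ is a Serre subcategory of $\mathrm{Art}(R)$.
   Context: $\mathrm{Art}(R)$ denotes the category (full subcategory of the category of $R$-modules) of artinian $R$-modules; it is an abelian category. A subcategory always means a nonempty full subcategory closed under isomorphism. A subcategory of an abelian category is called wide if it is closed under kernels, cokernels and extensions. A Serre subcategory is a wide subcategory which is moreover closed under subobjects. *)

theory Defs
  imports "HOL-Algebra.Algebra"
begin

definition mod_hom ::
  "('a, 'm) ring_scheme \<Rightarrow> ('a, 'b) module \<Rightarrow> ('a, 'c) module \<Rightarrow> ('b \<Rightarrow> 'c) set" where
  "mod_hom R M N =
     {f \<in> hom (add_monoid M) (add_monoid N).
        \<forall>r\<in>carrier R. \<forall>x\<in>carrier M. f (r \<odot>\<^bsub>M\<^esub> x) = r \<odot>\<^bsub>N\<^esub> f x}"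

abbreviation mod_kernel ::
  "('a, 'b) module \<Rightarrow> ('a, 'c) module \<Rightarrow> ('b \<Rightarrow> 'c) \<Rightarrow> 'b set" where
  "mod_kernel M N f \<equiv> kernel (add_monoid M) (add_monoid N) f"

definition mod_isomorphic ::
  "('a, 'm) ring_scheme \<Rightarrow> ('a, 'b) module \<Rightarrow> ('a, 'c) module \<Rightarrow> bool" where
  "mod_isomorphic R M N \<longleftrightarrow> (\<exists>f\<in>mod_hom R M N. bij_betw f (carrier M) (carrier N))"

definition artinian_module :: "('a, 'm) ring_scheme \<Rightarrow> ('a, 'b) module \<Rightarrow> bool" where
  "artinian_module R M \<longleftrightarrow> module R M \<and>
     (\<forall>N :: nat \<Rightarrow> 'b set.
        (\<forall>n. submodule (N n) R M \<and> N (Suc n) \<subseteq> N n) \<longrightarrow> (\<exists>k. \<forall>n\<ge>k. N n = N k))"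

text \<open>
  The objects of the category of artinian modules whose elements are taken from a type
  \<open>'b\<close>; the morphisms from \<open>M\<close> to \<open>N\<close> are \<^term>\<open>mod_hom R M N\<close>. The type \<open>'b\<close> plays the role
  of a universe. If \<open>'b\<close> is infinite, finite direct sums can be formed inside \<open>'b\<close>, and
  quotients always can (choose representatives of the cosets). If moreover \<open>'b\<close> has at least
  as many elements as \<open>R\<close> and \<open>R\<close> is noetherian, then every artinian \<open>R\<close>-module, being a
  countable union of submodules of finite length, has an isomorphic copy with elements in
  \<open>'b\<close>, so that this is all of \<open>Art(R)\<close> up to isomorphism.

  The records of type \<open>('a, 'b) module\<close> carry a multiplication and a unit as well as operations
  outside the carrier, all of which are ignored by isomorphisms of modules.
\<close>

definition Art :: "('a, 'm) ring_scheme \<Rightarrow> ('a, 'b) module set" where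
  "Art R = {M. artinian_module R M}"

definition subcategory :: "('a, 'm) ring_scheme \<Rightarrow> ('a, 'b) module set \<Rightarrow> bool" where
  "subcategory R C \<longleftrightarrow> C \<noteq> {} \<and> C \<subseteq> Art R \<and>
     (\<forall>M\<in>C. \<forall>N\<in>Art R. mod_isomorphic R M N \<longrightarrow> N \<in> C)"

text \<open>
  Kernels, cokernels and extensions are given by exact sequences of modules, so that they are
  determined up to isomorphism only.
\<close>

definition is_kernel ::
  "('a, 'm) ring_scheme \<Rightarrow> ('a, 'b) module \<Rightarrow> ('a, 'b) module \<Rightarrow> ('b \<Rightarrow> 'b) \<Rightarrow>
     ('a, 'b) module \<Rightarrow> ('b \<Rightarrow> 'b) \<Rightarrow> bool" where
  "is_kernel R M N f K i \<longleftrightarrow>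
     i \<in> mod_hom R K M \<and> inj_on i (carrier K) \<and> i ` carrier K = mod_kernel M N f"

definition is_cokernel ::
  "('a, 'm) ring_scheme \<Rightarrow> ('a, 'b) module \<Rightarrow> ('a, 'b) module \<Rightarrow> ('b \<Rightarrow> 'b) \<Rightarrow>
     ('a, 'b) module \<Rightarrow> ('b \<Rightarrow> 'b) \<Rightarrow> bool" where
  "is_cokernel R M N f Q p \<longleftrightarrow>
     p \<in> mod_hom R N Q \<and> p ` carrier N = carrier Q \<and> mod_kernel N Q p = f ` carrier M"

definition short_exact ::
  "('a, 'm) ring_scheme \<Rightarrow> ('a, 'b) module \<Rightarrow> ('b \<Rightarrow> 'b) \<Rightarrow> ('a, 'b) module \<Rightarrow>
     ('b \<Rightarrow> 'b) \<Rightarrow> ('a, 'b) module \<Rightarrow> bool" where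
  "short_exact R L f M g N \<longleftrightarrow>
     f \<in> mod_hom R L M \<and> g \<in> mod_hom R M N \<and>
     inj_on f (carrier L) \<and> f ` carrier L = mod_kernel M N g \<and> g ` carrier M = carrier N"

definition closed_under_kernels :: "('a, 'm) ring_scheme \<Rightarrow> ('a, 'b) module set \<Rightarrow> bool" where
  "closed_under_kernels R C \<longleftrightarrow>
     (\<forall>M\<in>C. \<forall>N\<in>C. \<forall>f\<in>mod_hom R M N. \<forall>K\<in>Art R. \<forall>i. is_kernel R M N f K i \<longrightarrow> K \<in> C)"

definition closed_under_cokernels :: "('a, 'm) ring_scheme \<Rightarrow> ('a, 'b) module set \<Rightarrow> bool" where
  "closed_under_cokernels R C \<longleftrightarrow>
     (\<forall>M\<in>C. \<forall>N\<in>C. \<forall>f\<in>mod_hom R M N. \<forall>Q\<in>Art R. \<forall>p. is_cokernel R M N f Q p \<longrightarrow> Q \<in> C)"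

definition closed_under_extensions :: "('a, 'm) ring_scheme \<Rightarrow> ('a, 'b) module set \<Rightarrow> bool" where
  "closed_under_extensions R C \<longleftrightarrow>
     (\<forall>L\<in>C. \<forall>N\<in>C. \<forall>M\<in>Art R. \<forall>f g. short_exact R L f M g N \<longrightarrow> M \<in> C)"

text \<open>Monomorphisms of artinian modules are the injective homomorphisms.\<close>

definition closed_under_subobjects :: "('a, 'm) ring_scheme \<Rightarrow> ('a, 'b) module set \<Rightarrow> bool" where
  "closed_under_subobjects R C \<longleftrightarrow>
     (\<forall>M\<in>C. \<forall>N\<in>Art R. \<forall>i\<in>mod_hom R N M. inj_on i (carrier N) \<longrightarrow> N \<in> C)"

definition wide_subcategory :: "('a, 'm) ring_scheme \<Rightarrow> ('a, 'b) module set \<Rightarrow> bool" where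
  "wide_subcategory R C \<longleftrightarrow>
     subcategory R C \<and> closed_under_kernels R C \<and> closed_under_cokernels R C \<and>
     closed_under_extensions R C"

definition Serre_subcategory :: "('a, 'm) ring_scheme \<Rightarrow> ('a, 'b) module set \<Rightarrow> bool" where
  "Serre_subcategory R C \<longleftrightarrow> wide_subcategory R C \<and> closed_under_subobjects R C"

end

theory Submission
  imports Defs
begin

text \<open>
  Let \<open>N\<close> be a minimal submodule of \<open>M \<in> C\<close> that is not in \<open>C\<close>, let \<open>z \<in> N\<close> be nonzero, let \<open>M\<^sub>0\<close> be
  a minimal submodule of \<open>M\<close> that contains \<open>N\<close> and lies in \<open>C\<close>, and let \<open>K\<close> be a maximal submodule
  of \<open>M\<close> avoiding \<open>z\<close>. Then \<open>M/K\<close> has a simple essential socle, generated by \<open>z\<close>, and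
  \<open>N\<^sub>0 = K \<inter> N\<close> lies in \<open>C\<close>, as it is properly contained in \<open>N\<close>.

  Suppose that some \<open>x \<in> M\<^sub>0\<close> is not in \<open>N + K\<close>. In a module with simple essential socle, finitely
  generated submodules are determined by their annihilators (the elementary part of Matlis
  duality), so for finitely many elements of \<open>N\<close> there is \<open>t \<in> R\<close> mapping them into \<open>K\<close>, with
  \<open>t x \<equiv> z\<close> modulo \<open>K\<close>. By linear compactness of artinian modules these scalars glue to an
  endomorphism \<open>s\<close> of \<open>M\<close> that agrees with a scalar on each finite set, maps \<open>N\<close> into \<open>N\<^sub>0\<close>, and
  satisfies \<open>s x \<equiv> z\<close> modulo \<open>K\<close>. The kernel of \<open>M\<^sub>0 \<rightarrow> M\<^sub>0/N\<^sub>0\<close> induced by \<open>s\<close> is in \<open>C\<close>, contains \<open>N\<close>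
  but not \<open>x\<close>, contrary to the choice of \<open>M\<^sub>0\<close>.

  Hence \<open>M\<^sub>0/N\<^sub>0\<close> is the direct sum of \<open>N/N\<^sub>0\<close> and \<open>(K \<inter> M\<^sub>0)/N\<^sub>0\<close>, and its projection onto
  \<open>N/N\<^sub>0\<close> shows that \<open>K \<inter> M\<^sub>0\<close>, then \<open>M\<^sub>0/(K \<inter> M\<^sub>0) \<cong> N/N\<^sub>0\<close> and finally \<open>N\<close> are in \<open>C\<close>.
\<close>

section \<open>Modules with simple essential socle\<close>

text \<open>A descent in this relation would be a chain that never becomes stationary. As a
  well-founded relation, the chain condition serves both for minimal choices and for induction over
  submodules.\<close>

lemma artinian_wf:
  assumes "artinian_module R M"
  shows "wf {(A, B). submodule A R M \<and> submodule B R M \<and> A \<subset> B}"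
  unfolding wf_iff_no_infinite_down_chain
proof (rule notI, elim exE)
  fix f assume f: "\<forall>i. (f (Suc i), f i) \<in> {(A, B). submodule A R M \<and> submodule B R M \<and> A \<subset> B}"
  then have "\<exists>k. \<forall>n\<ge>k. f n = f k"
    using assms unfolding artinian_module_def by (auto simp: psubset_eq)
  then obtain k where "f (Suc k) = f k" by (meson le_Suc_eq order_refl)
  then show False using f by auto
qed

text \<open>Zorn's lemma applies because over a noetherian ring the union of a nonempty chain of
  ideals is a member of the chain.\<close>

lemma (in noetherian_ring) maximal_ideal_in:
  assumes "\<And>I. I \<in> \<I> \<Longrightarrow> ideal I R" "\<I> \<noteq> {}"
  obtains I where "I \<in> \<I>" "\<And>J. J \<in> \<I> \<Longrightarrow> I \<subseteq> J \<Longrightarrow> J = I"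
proof -
  have "\<exists>I\<in>\<I>. \<forall>J\<in>\<I>. I \<subseteq> J \<longrightarrow> J = I"
  proof (rule subset_Zorn_nonempty)
    fix \<C> assume C: "\<C> \<noteq> {}" "subset.chain \<I> \<C>"
    then have sub: "\<C> \<subseteq> \<I>" unfolding subset_chain_def by simp
    then have "\<C> \<subseteq> {I. ideal I R}" by (intro subsetI CollectI assms(1)) (rule subsetD)
    then have "subset.chain {I. ideal I R} \<C>"
      using C(2) unfolding subset_chain_def by simp
    then have "\<Union>\<C> \<in> \<C>" by (rule ideal_chain_is_trivial[OF C(1)])
    then show "\<Union>\<C> \<in> \<I>" by (rule subsetD[OF sub])
  qed (rule assms(2))
  then obtain I where "I \<in> \<I>" "\<forall>J\<in>\<I>. I \<subseteq> J \<longrightarrow> J = I" ..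
  then show thesis by (intro that[of I]) simp_all
qed

context module
begin

lemma submoduleD:
  assumes "submodule H R M"
  shows "\<zero>\<^bsub>M\<^esub> \<in> H" "\<And>x. x \<in> H \<Longrightarrow> x \<in> carrier M"
    "\<And>a b. a \<in> H \<Longrightarrow> b \<in> H \<Longrightarrow> a \<oplus>\<^bsub>M\<^esub> b \<in> H"
    "\<And>r x. r \<in> carrier R \<Longrightarrow> x \<in> H \<Longrightarrow> r \<odot>\<^bsub>M\<^esub> x \<in> H"
    "\<And>x. x \<in> H \<Longrightarrow> \<ominus>\<^bsub>M\<^esub> x \<in> H"
    "\<And>a b. a \<in> H \<Longrightarrow> b \<in> H \<Longrightarrow> a \<ominus>\<^bsub>M\<^esub> b \<in> H"
proof -
  note H = submodule.axioms(1)[OF assms]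
  show "\<zero>\<^bsub>M\<^esub> \<in> H" using subgroup.one_closed[OF H] by simp
  show "\<And>x. x \<in> H \<Longrightarrow> x \<in> carrier M" using subgroup.mem_carrier[OF H] by simp
  show "\<And>r x. r \<in> carrier R \<Longrightarrow> x \<in> H \<Longrightarrow> r \<odot>\<^bsub>M\<^esub> x \<in> H"
    by (rule submodule.smult_closed[OF assms])
  show add: "\<And>a b. a \<in> H \<Longrightarrow> b \<in> H \<Longrightarrow> a \<oplus>\<^bsub>M\<^esub> b \<in> H"
    using subgroup.m_closed[OF H] by simp
  show neg: "\<And>x. x \<in> H \<Longrightarrow> \<ominus>\<^bsub>M\<^esub> x \<in> H"
    unfolding a_inv_def by (rule subgroup.m_inv_closed[OF H])
  show "\<And>a b. a \<in> H \<Longrightarrow> b \<in> H \<Longrightarrow> a \<ominus>\<^bsub>M\<^esub> b \<in> H"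
    unfolding a_minus_def by (intro add neg)
qed

lemma submodule_smult_ideal:
  assumes "ideal J R" "y \<in> carrier M"
  shows "submodule ((\<lambda>a. a \<odot>\<^bsub>M\<^esub> y) ` J) R M"
proof -
  interpret ideal J R by fact
  show ?thesis
  proof (rule submoduleI)
    show "\<zero>\<^bsub>M\<^esub> \<in> (\<lambda>a. a \<odot>\<^bsub>M\<^esub> y) ` J"
      using assms(2) by (intro image_eqI[of _ _ \<zero>]) auto
  next
    fix a assume "a \<in> (\<lambda>a. a \<odot>\<^bsub>M\<^esub> y) ` J"
    then obtain r where "r \<in> J" "a = r \<odot>\<^bsub>M\<^esub> y" by auto
    then show "\<ominus>\<^bsub>M\<^esub> a \<in> (\<lambda>a. a \<odot>\<^bsub>M\<^esub> y) ` J"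
      using assms(2) by (intro image_eqI[of _ _ "\<ominus> r"]) (auto simp: smult_l_minus)
  next
    fix a b assume "a \<in> (\<lambda>a. a \<odot>\<^bsub>M\<^esub> y) ` J" "b \<in> (\<lambda>a. a \<odot>\<^bsub>M\<^esub> y) ` J"
    then obtain r s where "r \<in> J" "a = r \<odot>\<^bsub>M\<^esub> y" "s \<in> J" "b = s \<odot>\<^bsub>M\<^esub> y" by auto
    then show "a \<oplus>\<^bsub>M\<^esub> b \<in> (\<lambda>a. a \<odot>\<^bsub>M\<^esub> y) ` J"
      using assms(2) by (intro image_eqI[of _ _ "r \<oplus> s"]) (auto simp: smult_l_distr)
  next
    fix c b assume "c \<in> carrier R" "b \<in> (\<lambda>a. a \<odot>\<^bsub>M\<^esub> y) ` J"
    then obtain s where "c \<in> carrier R" "s \<in> J" "b = s \<odot>\<^bsub>M\<^esub> y" by auto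
    then show "c \<odot>\<^bsub>M\<^esub> b \<in> (\<lambda>a. a \<odot>\<^bsub>M\<^esub> y) ` J"
      using assms(2) by (intro image_eqI[of _ _ "c \<otimes> s"]) (auto simp: smult_assoc1 I_l_closed)
  qed (use assms(2) in auto)
qed

text \<open>This is the colon ideal \<open>(N : y)\<close>; for the zero submodule it is the
  annihilator of \<open>y\<close>.\<close>

lemma ideal_preimage_submodule:
  assumes N: "submodule N R M" and y: "y \<in> carrier M"
  shows "ideal {a \<in> carrier R. a \<odot>\<^bsub>M\<^esub> y \<in> N} R" (is "ideal ?I R")
proof (rule idealI[OF R.ring_axioms])
  have closed: "x \<otimes> a \<in> ?I" if "a \<in> ?I" "x \<in> carrier R" for a x
    using that y submoduleD(4)[OF N] by (simp add: smult_assoc1)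
  show "subgroup ?I (add_monoid R)"
  proof (rule R.add.subgroupI)
    show "?I \<noteq> {}" using submoduleD(1)[OF N] smult_l_null[OF y] R.zero_closed by force
  next
    fix a b assume "a \<in> ?I" "b \<in> ?I"
    then show "a \<oplus> b \<in> ?I"
      using y submoduleD(3)[OF N] by (simp add: smult_l_distr)
  next
    fix a assume "a \<in> ?I"
    then show "\<ominus> a \<in> ?I" using y submoduleD(5)[OF N] by (simp add: smult_l_minus)
  qed auto
  fix a x assume "a \<in> ?I" "x \<in> carrier R"
  then show "x \<otimes> a \<in> ?I" by (rule closed)
  then show "a \<otimes> x \<in> ?I"
    using \<open>a \<in> ?I\<close> \<open>x \<in> carrier R\<close> by (simp add: R.m_comm)
qed

lemma submodule_zero: "submodule {\<zero>\<^bsub>M\<^esub>} R M"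
  by (rule submoduleI) auto

text \<open>The factor \<open>carrier R\<close> is the value for the empty family, where
  \<open>\<Inter>S\<close> is the whole type.\<close>

lemma ideal_Inter_carrier:
  assumes "\<And>I. I \<in> S \<Longrightarrow> ideal I R"
  shows "ideal (carrier R \<inter> \<Inter>S) R"
proof (cases "S = {}")
  case True
  then show ?thesis using R.oneideal by simp
next
  case False
  then have "carrier R \<inter> \<Inter>S = \<Inter>S"
    using assms additive_subgroup.a_subset[OF ideal.axioms(1)] by blast
  then show ?thesis using R.i_Intersect[of S] assms False by simp
qed

lemma ideal_annihilator:
  assumes "Y \<subseteq> carrier M"
  shows "ideal {a \<in> carrier R. \<forall>y\<in>Y. a \<odot>\<^bsub>M\<^esub> y = \<zero>\<^bsub>M\<^esub>} R"
proof -
  have "ideal (carrier R \<inter> \<Inter>((\<lambda>y. {a \<in> carrier R. a \<odot>\<^bsub>M\<^esub> y \<in> {\<zero>\<^bsub>M\<^esub>}}) ` Y)) R"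
    using assms ideal_preimage_submodule[OF submodule_zero] by (intro ideal_Inter_carrier) blast
  also have "carrier R \<inter> \<Inter>((\<lambda>y. {a \<in> carrier R. a \<odot>\<^bsub>M\<^esub> y \<in> {\<zero>\<^bsub>M\<^esub>}}) ` Y) =
     {a \<in> carrier R. \<forall>y\<in>Y. a \<odot>\<^bsub>M\<^esub> y = \<zero>\<^bsub>M\<^esub>}" by blast
  finally show ?thesis .
qed

section \<open>Homomorphisms from ideals and double annihilators\<close>

text \<open>Linearity is required on \<open>J\<close> only, so that an ideal does not have to be
  turned into a module record.\<close>

definition lin_on :: "'a set \<Rightarrow> ('a \<Rightarrow> 'c) \<Rightarrow> bool" where
  "lin_on J h \<longleftrightarrow> (\<forall>a\<in>J. h a \<in> carrier M) \<and>
     (\<forall>a\<in>J. \<forall>b\<in>J. h (a \<oplus> b) = h a \<oplus>\<^bsub>M\<^esub> h b) \<and>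
     (\<forall>r\<in>carrier R. \<forall>a\<in>J. h (r \<otimes> a) = r \<odot>\<^bsub>M\<^esub> h a)"

text \<open>A linear \<open>h\<close> on \<open>J\<close> that vanishes on the annihilator of
  \<open>y\<close> in \<open>J\<close> amounts to a homomorphism from the submodule
  \<open>J y\<close> to \<open>M\<close>. The property says that all of these are multiplications by
  elements of \<open>R\<close>.\<close>

definition homs_are_smults :: "'a set \<Rightarrow> 'c \<Rightarrow> bool" where
  "homs_are_smults J y \<longleftrightarrow>
     (\<forall>h. lin_on J h \<and> (\<forall>a\<in>J. a \<odot>\<^bsub>M\<^esub> y = \<zero>\<^bsub>M\<^esub> \<longrightarrow> h a = \<zero>\<^bsub>M\<^esub>) \<longrightarrow>
       (\<exists>c\<in>carrier R. \<forall>a\<in>J. h a = c \<odot>\<^bsub>M\<^esub> (a \<odot>\<^bsub>M\<^esub> y)))"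

text \<open>Induction on \<open>Y\<close>. On the annihilator \<open>J\<close> of the remaining
  elements, \<open>a x\<close> depends only on \<open>a y\<close>, so it equals
  \<open>c (a y)\<close> for some \<open>c\<close>; then \<open>x - c y\<close> is killed by
  \<open>J\<close>, and the induction hypothesis puts it into \<open>N\<close>.\<close>

lemma double_annihilator:
  assumes "finite Y" "submodule N R M" "Y \<subseteq> N"
    and "\<And>y J. y \<in> Y \<Longrightarrow> ideal J R \<Longrightarrow> homs_are_smults J y"
    and "x \<in> carrier M"
    and "\<And>t. t \<in> carrier R \<Longrightarrow> \<forall>y\<in>Y. t \<odot>\<^bsub>M\<^esub> y = \<zero>\<^bsub>M\<^esub> \<Longrightarrow> t \<odot>\<^bsub>M\<^esub> x = \<zero>\<^bsub>M\<^esub>"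
  shows "x \<in> N"
  using assms
proof (induction Y arbitrary: x rule: finite_induct)
  case empty
  have "\<one> \<odot>\<^bsub>M\<^esub> x = \<zero>\<^bsub>M\<^esub>" by (rule empty.prems(5)) auto
  then have "x = \<zero>\<^bsub>M\<^esub>" using empty.prems(4) by simp
  then show ?case using submoduleD(1)[OF empty.prems(1)] by simp
next
  case (insert y Y)
  note N = submoduleD[OF insert.prems(1)]
  define J where "J = {a \<in> carrier R. \<forall>y\<in>Y. a \<odot>\<^bsub>M\<^esub> y = \<zero>\<^bsub>M\<^esub>}"
  have "insert y Y \<subseteq> carrier M" using insert.prems(2) N(2) by (intro subsetI) blast
  then have J: "ideal J R" and y: "y \<in> carrier M"
    unfolding J_def by (auto intro!: ideal_annihilator)
  note x = insert.prems(4)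
  have "lin_on J (\<lambda>a. a \<odot>\<^bsub>M\<^esub> x)"
    unfolding lin_on_def J_def using x by (auto simp: smult_l_distr smult_assoc1)
  moreover have "\<forall>a\<in>J. a \<odot>\<^bsub>M\<^esub> y = \<zero>\<^bsub>M\<^esub> \<longrightarrow> a \<odot>\<^bsub>M\<^esub> x = \<zero>\<^bsub>M\<^esub>"
  proof (intro ballI impI)
    fix a assume "a \<in> J" "a \<odot>\<^bsub>M\<^esub> y = \<zero>\<^bsub>M\<^esub>"
    then show "a \<odot>\<^bsub>M\<^esub> x = \<zero>\<^bsub>M\<^esub>" by (intro insert.prems(5)) (simp_all add: J_def)
  qed
  ultimately obtain c where c: "c \<in> carrier R" "\<forall>a\<in>J. a \<odot>\<^bsub>M\<^esub> x = c \<odot>\<^bsub>M\<^esub> (a \<odot>\<^bsub>M\<^esub> y)"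
    using insert.prems(3)[OF insertI1 J, unfolded homs_are_smults_def, rule_format,
        of "\<lambda>a. a \<odot>\<^bsub>M\<^esub> x"] by blast
  have "x \<ominus>\<^bsub>M\<^esub> c \<odot>\<^bsub>M\<^esub> y \<in> N"
  proof (rule insert.IH)
    fix t assume t: "t \<in> carrier R" "\<forall>y\<in>Y. t \<odot>\<^bsub>M\<^esub> y = \<zero>\<^bsub>M\<^esub>"
    then have "t \<odot>\<^bsub>M\<^esub> x = c \<odot>\<^bsub>M\<^esub> (t \<odot>\<^bsub>M\<^esub> y)" using c(2) by (simp add: J_def)
    also have "\<dots> = t \<odot>\<^bsub>M\<^esub> (c \<odot>\<^bsub>M\<^esub> y)"
      using t c y by (simp add: smult_assoc1[symmetric] R.m_comm)
    finally show "t \<odot>\<^bsub>M\<^esub> (x \<ominus>\<^bsub>M\<^esub> c \<odot>\<^bsub>M\<^esub> y) = \<zero>\<^bsub>M\<^esub>"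
      using t c y x by (simp add: a_minus_def smult_r_distr smult_r_minus M.r_neg)
    next
    show "Y \<subseteq> N" using insert.prems(2) by simp
    show "x \<ominus>\<^bsub>M\<^esub> c \<odot>\<^bsub>M\<^esub> y \<in> carrier M" using x y c by simp
    show "\<And>y J. y \<in> Y \<Longrightarrow> ideal J R \<Longrightarrow> homs_are_smults J y" using insert.prems(3) by simp
  qed (rule insert.prems(1))
  moreover have "c \<odot>\<^bsub>M\<^esub> y \<in> N" using insert.prems(2) by (intro N(4) c(1)) simp
  ultimately have "(x \<ominus>\<^bsub>M\<^esub> c \<odot>\<^bsub>M\<^esub> y) \<oplus>\<^bsub>M\<^esub> c \<odot>\<^bsub>M\<^esub> y \<in> N" by (rule N(3))
  then show ?case using x y c by (simp add: a_minus_def M.a_assoc M.l_neg)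
qed

lemma lin_onD:
  assumes "lin_on J h"
  shows "\<And>a. a \<in> J \<Longrightarrow> h a \<in> carrier M"
    "\<And>a b. a \<in> J \<Longrightarrow> b \<in> J \<Longrightarrow> h (a \<oplus> b) = h a \<oplus>\<^bsub>M\<^esub> h b"
    "\<And>r a. r \<in> carrier R \<Longrightarrow> a \<in> J \<Longrightarrow> h (r \<otimes> a) = r \<odot>\<^bsub>M\<^esub> h a"
  using assms unfolding lin_on_def by simp_all

text \<open>By \<open>maximal\<close>, the module \<open>J y / I y\<close> is simple. After a
  correction by a scalar, a homomorphism on \<open>J y\<close> factors through it, as does
  multiplication by \<open>t\<close>. Both then take values in the simple socle generated by
  \<open>z\<close>, so the former is a scalar multiple of the latter.\<close>

lemma homs_are_smults_step:
  assumes J: "ideal J R" and I: "ideal I R" "I \<subseteq> J" and y: "y \<in> carrier M"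
    and maximal: "\<And>L. ideal L R \<Longrightarrow> I \<subset> L \<Longrightarrow> L \<subseteq> J \<Longrightarrow> \<forall>a\<in>J. \<exists>b\<in>L. a \<odot>\<^bsub>M\<^esub> y = b \<odot>\<^bsub>M\<^esub> y"
    and I_homs: "homs_are_smults I y"
    and t: "t \<in> carrier R" "\<And>a. a \<in> I \<Longrightarrow> t \<odot>\<^bsub>M\<^esub> (a \<odot>\<^bsub>M\<^esub> y) = \<zero>\<^bsub>M\<^esub>"
    and j: "j \<in> J" "t \<odot>\<^bsub>M\<^esub> (j \<odot>\<^bsub>M\<^esub> y) \<noteq> \<zero>\<^bsub>M\<^esub>"
    and z: "z \<in> carrier M" "z \<noteq> \<zero>\<^bsub>M\<^esub>"
      "\<And>v. v \<in> carrier M \<Longrightarrow> v \<noteq> \<zero>\<^bsub>M\<^esub> \<Longrightarrow> \<exists>a\<in>carrier R. a \<odot>\<^bsub>M\<^esub> v = z"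
  shows "homs_are_smults J y"
  unfolding homs_are_smults_def
proof (intro allI impI, elim conjE)
  fix h assume h: "lin_on J h" and h0: "\<forall>a\<in>J. a \<odot>\<^bsub>M\<^esub> y = \<zero>\<^bsub>M\<^esub> \<longrightarrow> h a = \<zero>\<^bsub>M\<^esub>"
  interpret J: ideal J R by fact
  interpret I: ideal I R by fact
  note JR = J.a_Hcarr and IR = I.a_Hcarr
  have jR: "j \<in> carrier R" using j(1) by simp
  have "lin_on I h" "\<forall>a\<in>I. a \<odot>\<^bsub>M\<^esub> y = \<zero>\<^bsub>M\<^esub> \<longrightarrow> h a = \<zero>\<^bsub>M\<^esub>"
    using h h0 I(2) unfolding lin_on_def subset_iff by simp_all
  then obtain c where c: "c \<in> carrier R" "\<forall>a\<in>I. h a = c \<odot>\<^bsub>M\<^esub> (a \<odot>\<^bsub>M\<^esub> y)"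
    using I_homs[unfolded homs_are_smults_def, rule_format, of h] by blast
  \<comment> \<open>Subtracting the multiplication that agrees with \<open>h\<close> on
    \<open>I\<close> leaves a map that vanishes on \<open>I\<close> and on the annihilator of
    \<open>y\<close> in \<open>J\<close>; it factors through \<open>J y / I y\<close>.\<close>
  define g where "g = (\<lambda>a. h a \<ominus>\<^bsub>M\<^esub> c \<odot>\<^bsub>M\<^esub> (a \<odot>\<^bsub>M\<^esub> y))"
  have g_closed: "g a \<in> carrier M" if "a \<in> J" for a
    using lin_onD(1)[OF h that] JR[OF that] c y unfolding g_def by simp
  have g_add: "g (a \<oplus> b) = g a \<oplus>\<^bsub>M\<^esub> g b" if "a \<in> J" "b \<in> J" for a b
    using lin_onD(1,2)[OF h] that JR c y unfolding g_def
    by (simp add: a_minus_def smult_l_distr smult_r_distr M.minus_add M.a_ac)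
  have g_smult: "g (r \<otimes> a) = r \<odot>\<^bsub>M\<^esub> g a" if "a \<in> J" "r \<in> carrier R" for a r
  proof -
    have "c \<odot>\<^bsub>M\<^esub> (r \<otimes> a \<odot>\<^bsub>M\<^esub> y) = r \<odot>\<^bsub>M\<^esub> (c \<odot>\<^bsub>M\<^esub> (a \<odot>\<^bsub>M\<^esub> y))"
      using that JR[OF that(1)] c y
      by (simp add: smult_assoc1[symmetric] R.m_lcomm)
    then show ?thesis
      using lin_onD(1,3)[OF h] that JR[OF that(1)] c y unfolding g_def
      by (simp add: a_minus_def smult_r_distr smult_r_minus)
  qed
  have g_I: "g a = \<zero>\<^bsub>M\<^esub>" if "a \<in> I" for a
    using c that IR[OF that] y unfolding g_def by (simp add: a_minus_def M.r_neg)
  have g_ann: "g a = \<zero>\<^bsub>M\<^esub>" if "a \<in> J" "a \<odot>\<^bsub>M\<^esub> y = \<zero>\<^bsub>M\<^esub>" for a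
    using h0 that c unfolding g_def by (simp add: a_minus_def)
  \<comment> \<open>Any \<open>l\<close> in \<open>J\<close> outside \<open>I\<close> generates,
    together with \<open>I\<close>, an ideal whose image is already \<open>J y\<close>: this is the
    simplicity of \<open>J y / I y\<close>.\<close>
  have span: "\<exists>i\<in>I. \<exists>r\<in>carrier R. a \<odot>\<^bsub>M\<^esub> y = (i \<oplus> r \<otimes> l) \<odot>\<^bsub>M\<^esub> y"
    if l: "l \<in> J" "l \<notin> I" and a: "a \<in> J" for a l
  proof -
    have lR: "l \<in> carrier R" using l by simp
    have L: "ideal (I <+>\<^bsub>R\<^esub> PIdl l) R"
      by (rule R.add_ideals[OF I(1) R.cgenideal_ideal[OF lR]])
    have "I \<subseteq> I <+>\<^bsub>R\<^esub> PIdl l"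
    proof
      fix i assume "i \<in> I"
      then have "i = i \<oplus> \<zero> \<otimes> l" using lR by simp
      then show "i \<in> I <+>\<^bsub>R\<^esub> PIdl l" using \<open>i \<in> I\<close> R.zero_closed
        unfolding set_add_def' cgenideal_def by blast
    qed
    moreover have "l \<in> I <+>\<^bsub>R\<^esub> PIdl l"
    proof -
      have "l = \<zero> \<oplus> \<one> \<otimes> l" using lR by simp
      then show ?thesis using I.zero_closed R.one_closed
        unfolding set_add_def' cgenideal_def by blast
    qed
    moreover have "I <+>\<^bsub>R\<^esub> PIdl l \<subseteq> J"
      using I(2) l(1) J.I_l_closed unfolding set_add_def' cgenideal_def by auto
    ultimately obtain b where "b \<in> I <+>\<^bsub>R\<^esub> PIdl l" "a \<odot>\<^bsub>M\<^esub> y = b \<odot>\<^bsub>M\<^esub> y"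
      using maximal[OF L] l(2) a by blast
    then show ?thesis unfolding set_add_def' cgenideal_def by blast
  qed
  define v where "v = t \<odot>\<^bsub>M\<^esub> (j \<odot>\<^bsub>M\<^esub> y)"
  have v: "v \<in> carrier M" "v \<noteq> \<zero>\<^bsub>M\<^esub>" using t(1) jR y j(2) unfolding v_def by auto
  have j_notin: "j \<notin> I" using t(2) j(2) by blast
  \<comment> \<open>The elements \<open>a\<close> and \<open>i + r j\<close> have the same product
    with \<open>y\<close>, so \<open>g\<close> takes the same value on them; both \<open>g\<close>
    and multiplication by \<open>t\<close> kill the part from \<open>I\<close>.\<close>
  have g_j: "g a = r \<odot>\<^bsub>M\<^esub> g j \<and> t \<odot>\<^bsub>M\<^esub> (a \<odot>\<^bsub>M\<^esub> y) = r \<odot>\<^bsub>M\<^esub> v"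
    if a: "a \<in> J" and i: "i \<in> I" and r: "r \<in> carrier R"
      and eq: "a \<odot>\<^bsub>M\<^esub> y = (i \<oplus> r \<otimes> j) \<odot>\<^bsub>M\<^esub> y" for a i r
  proof
    have iR: "i \<in> carrier R" and iJ: "i \<in> J" and aR: "a \<in> carrier R" and rj: "r \<otimes> j \<in> J"
      using i I(2) a r j(1) J.I_l_closed by auto
    have d: "a \<ominus> (i \<oplus> r \<otimes> j) \<in> J" using a iJ rj by (simp add: a_minus_def)
    have "(a \<ominus> (i \<oplus> r \<otimes> j)) \<odot>\<^bsub>M\<^esub> y = a \<odot>\<^bsub>M\<^esub> y \<ominus>\<^bsub>M\<^esub> (i \<oplus> r \<otimes> j) \<odot>\<^bsub>M\<^esub> y"
      using aR iR r jR y unfolding a_minus_def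
      by (subst smult_l_distr) (auto simp del: R.minus_add simp: smult_l_minus)
    also have "\<dots> = \<zero>\<^bsub>M\<^esub>" using eq y iR r jR by (simp add: a_minus_def M.r_neg)
    finally have g0: "g (a \<ominus> (i \<oplus> r \<otimes> j)) = \<zero>\<^bsub>M\<^esub>" using g_ann d by blast
    have "a = (a \<ominus> (i \<oplus> r \<otimes> j)) \<oplus> (i \<oplus> r \<otimes> j)"
      using aR iR r jR by (simp add: a_minus_def R.a_assoc R.l_neg del: R.minus_add)
    then have "g a = g (a \<ominus> (i \<oplus> r \<otimes> j)) \<oplus>\<^bsub>M\<^esub> (g i \<oplus>\<^bsub>M\<^esub> g (r \<otimes> j))"
      using g_add[OF d, of "i \<oplus> r \<otimes> j"] g_add[OF iJ rj] iJ rj by simp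
    also have "\<dots> = r \<odot>\<^bsub>M\<^esub> g j"
      using g0 g_I[OF i] g_smult[OF j(1) r] g_closed[OF j(1)] r by simp
    finally show "g a = r \<odot>\<^bsub>M\<^esub> g j" .
    have "t \<odot>\<^bsub>M\<^esub> (a \<odot>\<^bsub>M\<^esub> y) = t \<odot>\<^bsub>M\<^esub> (i \<odot>\<^bsub>M\<^esub> y) \<oplus>\<^bsub>M\<^esub> t \<odot>\<^bsub>M\<^esub> (r \<odot>\<^bsub>M\<^esub> (j \<odot>\<^bsub>M\<^esub> y))"
      unfolding eq using t(1) iR r jR y by (simp add: smult_l_distr smult_r_distr smult_assoc1)
    also have "\<dots> = r \<odot>\<^bsub>M\<^esub> v"
      unfolding v_def using t(2)[OF i] t(1) r jR y
      by (simp add: smult_assoc1[symmetric] R.m_ac)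
    finally show "t \<odot>\<^bsub>M\<^esub> (a \<odot>\<^bsub>M\<^esub> y) = r \<odot>\<^bsub>M\<^esub> v" .
  qed
  have w: "g j \<in> carrier M" using g_closed j(1) .
  \<comment> \<open>If \<open>g j\<close> is nonzero, both elements reach \<open>z\<close>:
    \<open>b (g j) = z = a v\<close>. As \<open>g (b j) = z\<close> is nonzero, \<open>b j\<close>
    is outside \<open>I\<close> and spans as well, so that
    \<open>g j = r b (g j) = r a v\<close>.\<close>
  have "\<exists>u\<in>carrier R. g j = u \<odot>\<^bsub>M\<^esub> v"
  proof (cases "g j = \<zero>\<^bsub>M\<^esub>")
    case True
    then show ?thesis using v by (intro bexI[of _ \<zero>]) auto
  next
    case False
    obtain b where b: "b \<in> carrier R" "b \<odot>\<^bsub>M\<^esub> g j = z" using z(3)[OF w False] by blast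
    obtain a where a: "a \<in> carrier R" "a \<odot>\<^bsub>M\<^esub> v = z" using z(3)[OF v] by blast
    have bj: "b \<otimes> j \<in> J" using J.I_l_closed[OF j(1) b(1)] .
    have "g (b \<otimes> j) = z" using g_smult[OF j(1) b(1)] b(2) by simp
    then have "b \<otimes> j \<notin> I" using g_I z(2) by blast
    then obtain i r where i: "i \<in> I" and r: "r \<in> carrier R"
      and eq: "j \<odot>\<^bsub>M\<^esub> y = (i \<oplus> r \<otimes> (b \<otimes> j)) \<odot>\<^bsub>M\<^esub> y"
      using span[OF bj _ j(1)] by blast
    have "r \<otimes> (b \<otimes> j) = (r \<otimes> b) \<otimes> j" using r b jR by (simp add: R.m_assoc)
    then have "g j = (r \<otimes> b) \<odot>\<^bsub>M\<^esub> g j" using g_j[OF j(1) i _ , of "r \<otimes> b"] eq r b by simp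
    also have "\<dots> = r \<odot>\<^bsub>M\<^esub> (a \<odot>\<^bsub>M\<^esub> v)" using r b a w by (simp add: smult_assoc1)
    also have "\<dots> = (r \<otimes> a) \<odot>\<^bsub>M\<^esub> v" using r a v by (simp add: smult_assoc1)
    finally show ?thesis using r a by blast
  qed
  then obtain u where u: "u \<in> carrier R" "g j = u \<odot>\<^bsub>M\<^esub> v" by blast
  show "\<exists>c\<in>carrier R. \<forall>a\<in>J. h a = c \<odot>\<^bsub>M\<^esub> (a \<odot>\<^bsub>M\<^esub> y)"
  proof (intro bexI ballI)
    fix a assume a: "a \<in> J"
    obtain i r where i: "i \<in> I" and r: "r \<in> carrier R" and "a \<odot>\<^bsub>M\<^esub> y = (i \<oplus> r \<otimes> j) \<odot>\<^bsub>M\<^esub> y"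
      using span[OF j(1) j_notin a] by blast
    then have gj: "g a = r \<odot>\<^bsub>M\<^esub> (u \<odot>\<^bsub>M\<^esub> v)" "t \<odot>\<^bsub>M\<^esub> (a \<odot>\<^bsub>M\<^esub> y) = r \<odot>\<^bsub>M\<^esub> v"
      using g_j[OF a i r] u(2) by auto
    have aR: "a \<in> carrier R" using a by simp
    have ha: "h a \<in> carrier M" by (rule lin_onD(1)[OF h a])
    have "g a = u \<odot>\<^bsub>M\<^esub> (t \<odot>\<^bsub>M\<^esub> (a \<odot>\<^bsub>M\<^esub> y))"
      unfolding gj using u(1) r v by (simp add: smult_assoc1[symmetric] R.m_comm)
    moreover have "h a = c \<odot>\<^bsub>M\<^esub> (a \<odot>\<^bsub>M\<^esub> y) \<oplus>\<^bsub>M\<^esub> g a"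
      unfolding g_def using ha c(1) aR y by (simp add: a_minus_def M.a_ac M.r_neg2 M.r_neg1 M.r_neg)
    ultimately show "h a = (c \<oplus> u \<otimes> t) \<odot>\<^bsub>M\<^esub> (a \<odot>\<^bsub>M\<^esub> y)"
      using c(1) u(1) t(1) aR y by (simp add: smult_l_distr smult_assoc1)
  qed (use c u t in simp)
qed

text \<open>Well-founded induction on the image \<open>J y\<close>. An ideal \<open>I\<close>
  maximal among those in \<open>J\<close> with a smaller image makes \<open>J y / I y\<close>
  simple. The induction hypothesis covers \<open>I\<close> and, through double annihilators,
  supplies the scalar \<open>t\<close> for \<open>homs_are_smults_step\<close>.\<close>

lemma all_homs_are_smults:
  assumes art: "wf {(A, B). submodule A R M \<and> submodule B R M \<and> A \<subset> B}" and noeth: "noetherian_ring R"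
    and z: "z \<in> carrier M" "z \<noteq> \<zero>\<^bsub>M\<^esub>"
      "\<And>v. v \<in> carrier M \<Longrightarrow> v \<noteq> \<zero>\<^bsub>M\<^esub> \<Longrightarrow> \<exists>a\<in>carrier R. a \<odot>\<^bsub>M\<^esub> v = z"
    and "ideal J R" "y \<in> carrier M"
  shows "homs_are_smults J y"
proof -
  interpret noetherian_ring R by fact
  let ?im = "\<lambda>y J. (\<lambda>a. a \<odot>\<^bsub>M\<^esub> y) ` J"
  have "\<forall>J y. W = ?im y J \<longrightarrow> ideal J R \<longrightarrow> y \<in> carrier M \<longrightarrow> homs_are_smults J y" for W
  proof (induction W rule: wf_induct_rule[OF art], intro allI impI)
    fix W J y
    assume IH: "\<And>V. (V, W) \<in> {(A, B). submodule A R M \<and> submodule B R M \<and> A \<subset> B} \<Longrightarrow>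
        \<forall>J y. V = ?im y J \<longrightarrow> ideal J R \<longrightarrow> y \<in> carrier M \<longrightarrow> homs_are_smults J y"
      and W: "W = ?im y J" and J: "ideal J R" and y: "y \<in> carrier M"
    interpret J: ideal J R by fact
    show "homs_are_smults J y"
    proof (cases "\<forall>a\<in>J. a \<odot>\<^bsub>M\<^esub> y = \<zero>\<^bsub>M\<^esub>")
      case True
      then show ?thesis
        using R.zero_closed unfolding homs_are_smults_def by (auto intro!: bexI[of _ \<zero>])
    next
      case False
      define \<I> where "\<I> = {I. ideal I R \<and> I \<subseteq> J \<and> ?im y I \<noteq> ?im y J}"
      \<comment> \<open>The zero ideal qualifies because \<open>J y\<close> is nonzero in this
        case.\<close>
      have zero: "{\<zero>} \<in> \<I>"
        using R.zeroideal False y unfolding \<I>_def by force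
      obtain I where "I \<in> \<I>" and max: "\<And>L. L \<in> \<I> \<Longrightarrow> I \<subseteq> L \<Longrightarrow> L = I"

      proof (rule maximal_ideal_in[of \<I>])
        show "\<I> \<noteq> {}" using zero by blast
      qed (simp_all add: \<I>_def)
      then have I: "ideal I R" "I \<subseteq> J" "?im y I \<noteq> ?im y J" unfolding \<I>_def by auto
      then have im: "?im y I \<subset> ?im y J" by blast
      have subm: "submodule (?im y I) R M" "submodule W R M"
        unfolding W by (rule submodule_smult_ideal[OF I(1) y], rule submodule_smult_ideal[OF J y])
      \<comment> \<open>Double annihilators handle finitely many elements; the noetherian hypothesis
        provides the finite generating set \<open>A\<close>.\<close>
      obtain A where A: "A \<subseteq> carrier R" "finite A" "I = Idl A" using finetely_gen[OF I(1)] by blast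
      have AI: "A \<subseteq> I" unfolding A(3) by (rule genideal_self[OF A(1)])
      obtain j where j: "j \<in> J" "j \<odot>\<^bsub>M\<^esub> y \<notin> ?im y I" using im by blast
      have jy: "j \<odot>\<^bsub>M\<^esub> y \<in> carrier M" using j(1) y by simp
      \<comment> \<open>The image \<open>K x\<close> lies in \<open>I y\<close> and hence properly
        in \<open>J y\<close>, within reach of the induction hypothesis.\<close>
      have homs: "homs_are_smults K x" if x: "x \<in> ?im y A" and K: "ideal K R" for x K
      proof -
        obtain a where a: "a \<in> A" "x = a \<odot>\<^bsub>M\<^esub> y" using x by blast
        then have xI: "x \<in> ?im y I" using AI by blast
        then have xM: "x \<in> carrier M" using submoduleD(2)[OF subm(1)] by blast
        have "K \<subseteq> carrier R" by (rule additive_subgroup.a_subset[OF ideal.axioms(1)[OF K]])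
        then have "?im x K \<subseteq> ?im y I" using submoduleD(4)[OF subm(1) _ xI] by blast
        then have "?im x K \<subset> W" using im W by blast
        then show ?thesis
          using IH[of "?im x K", rule_format, of x K] submodule_smult_ideal[OF K xM] subm(2) K xM
          by simp
      qed
      \<comment> \<open>If every scalar killing \<open>A y\<close> also killed \<open>j y\<close>,
        the double annihilator property would put \<open>j y\<close> into
        \<open>I y\<close>.\<close>
      have "\<exists>t\<in>carrier R. (\<forall>x\<in>?im y A. t \<odot>\<^bsub>M\<^esub> x = \<zero>\<^bsub>M\<^esub>) \<and> t \<odot>\<^bsub>M\<^esub> (j \<odot>\<^bsub>M\<^esub> y) \<noteq> \<zero>\<^bsub>M\<^esub>"
      proof (rule ccontr)
        assume "\<not> ?thesis"
        then have "j \<odot>\<^bsub>M\<^esub> y \<in> ?im y I"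
          using AI by (intro double_annihilator[OF finite_imageI[OF A(2)] subm(1) _ homs jy]) auto
        then show False using j(2) by blast
      qed
      then obtain t where t: "t \<in> carrier R" "\<And>a. a \<in> A \<Longrightarrow> t \<odot>\<^bsub>M\<^esub> (a \<odot>\<^bsub>M\<^esub> y) = \<zero>\<^bsub>M\<^esub>"
         "t \<odot>\<^bsub>M\<^esub> (j \<odot>\<^bsub>M\<^esub> y) \<noteq> \<zero>\<^bsub>M\<^esub>" by blast
      have comm: "t \<odot>\<^bsub>M\<^esub> (a \<odot>\<^bsub>M\<^esub> y) = a \<odot>\<^bsub>M\<^esub> (t \<odot>\<^bsub>M\<^esub> y)" if "a \<in> carrier R" for a
        using t(1) that y by (simp add: smult_assoc1[symmetric] R.m_comm)
      \<comment> \<open>The scalars killing \<open>t y\<close> form an ideal containing the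
        generators \<open>A\<close>, hence containing \<open>I\<close>.\<close>
      have I_sub: "I \<subseteq> {a \<in> carrier R. a \<odot>\<^bsub>M\<^esub> (t \<odot>\<^bsub>M\<^esub> y) \<in> {\<zero>\<^bsub>M\<^esub>}}"
        unfolding A(3)
      proof (rule genideal_minimal)
        show "ideal {a \<in> carrier R. a \<odot>\<^bsub>M\<^esub> (t \<odot>\<^bsub>M\<^esub> y) \<in> {\<zero>\<^bsub>M\<^esub>}} R"
          using t(1) y by (intro ideal_preimage_submodule submodule_zero) simp
        show "A \<subseteq> {a \<in> carrier R. a \<odot>\<^bsub>M\<^esub> (t \<odot>\<^bsub>M\<^esub> y) \<in> {\<zero>\<^bsub>M\<^esub>}}"
          proof
          fix a assume "a \<in> A"
          then have "a \<in> carrier R" "t \<odot>\<^bsub>M\<^esub> (a \<odot>\<^bsub>M\<^esub> y) = \<zero>\<^bsub>M\<^esub>" using A(1) t(2) by blast+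
          then show "a \<in> {a \<in> carrier R. a \<odot>\<^bsub>M\<^esub> (t \<odot>\<^bsub>M\<^esub> y) \<in> {\<zero>\<^bsub>M\<^esub>}}"
            using comm[of a] by simp
        qed
      qed
      have tI: "t \<odot>\<^bsub>M\<^esub> (a \<odot>\<^bsub>M\<^esub> y) = \<zero>\<^bsub>M\<^esub>" if "a \<in> I" for a
      proof -
        have "a \<in> carrier R" "a \<odot>\<^bsub>M\<^esub> (t \<odot>\<^bsub>M\<^esub> y) = \<zero>\<^bsub>M\<^esub>" using that I_sub by blast+
        then show ?thesis using comm[of a] by simp
      qed
      show ?thesis
      proof (rule homs_are_smults_step[OF J I(1,2) y _ _ t(1) tI j(1) t(3) z])
        fix L assume L: "ideal L R" "I \<subset> L" "L \<subseteq> J"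
        then have "L \<notin> \<I>" using max by blast
        then have "?im y L = ?im y J" using L unfolding \<I>_def by blast
        then show "\<forall>a\<in>J. \<exists>b\<in>L. a \<odot>\<^bsub>M\<^esub> y = b \<odot>\<^bsub>M\<^esub> y" by blast
      next
        show "homs_are_smults I y" using IH[of "?im y I", rule_format, of y I] subm im W I(1) y by simp
      qed
    qed
  qed
  then show ?thesis using assms(6,7) by simp
qed

end

section \<open>Linear compactness\<close>

context module
begin

text \<open>The nonempty sets of this kind are the cosets of ideals. The formulation by three points
  names no ideal, admits the empty set and passes at once to intersections.\<close>

definition affine :: "'a set \<Rightarrow> bool" where
  "affine T \<longleftrightarrow> T \<subseteq> carrier R \<and>
    (\<forall>a\<in>T. \<forall>b\<in>T. \<forall>c\<in>T. \<forall>r\<in>carrier R. a \<oplus> r \<otimes> (b \<ominus> c) \<in> T)"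

lemma affine_Inter:
  assumes "\<And>T. T \<in> F \<Longrightarrow> affine T"
  shows "affine (carrier R \<inter> \<Inter>F)"
  using assms unfolding affine_def by (auto simp: a_minus_def)

text \<open>The solutions \<open>t\<close> of the congruence \<open>t x = y\<close> modulo
  \<open>K\<close>, if any exist, form a coset of the colon ideal \<open>(K : x)\<close>.\<close>

lemma affine_smult_fibre:
  assumes "x \<in> carrier M" "submodule K R M" "y \<in> carrier M"
  shows "affine {t \<in> carrier R. t \<odot>\<^bsub>M\<^esub> x \<ominus>\<^bsub>M\<^esub> y \<in> K}"
  unfolding affine_def
proof (intro conjI ballI)
  fix a b c r
  assume a: "a \<in> {t \<in> carrier R. t \<odot>\<^bsub>M\<^esub> x \<ominus>\<^bsub>M\<^esub> y \<in> K}" and b: "b \<in> {t \<in> carrier R. t \<odot>\<^bsub>M\<^esub> x \<ominus>\<^bsub>M\<^esub> y \<in> K}"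
    and c: "c \<in> {t \<in> carrier R. t \<odot>\<^bsub>M\<^esub> x \<ominus>\<^bsub>M\<^esub> y \<in> K}" and r: "r \<in> carrier R"
  note K = submoduleD[OF assms(2)]
  let ?k = "(a \<odot>\<^bsub>M\<^esub> x \<ominus>\<^bsub>M\<^esub> y) \<oplus>\<^bsub>M\<^esub> r \<odot>\<^bsub>M\<^esub> ((b \<odot>\<^bsub>M\<^esub> x \<ominus>\<^bsub>M\<^esub> y) \<ominus>\<^bsub>M\<^esub> (c \<odot>\<^bsub>M\<^esub> x \<ominus>\<^bsub>M\<^esub> y))"
  have "?k \<in> K" using a b c r by (auto intro!: K(3)[OF _ K(4)[OF _ K(6)]])
  moreover have "(b \<odot>\<^bsub>M\<^esub> x \<ominus>\<^bsub>M\<^esub> y) \<ominus>\<^bsub>M\<^esub> (c \<odot>\<^bsub>M\<^esub> x \<ominus>\<^bsub>M\<^esub> y) = (b \<ominus> c) \<odot>\<^bsub>M\<^esub> x"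
    using b c assms(1,3)
    by (simp add: a_minus_def smult_l_distr smult_l_minus M.minus_add M.a_ac M.r_neg2 M.r_neg1 M.r_neg)
  moreover have "(a \<odot>\<^bsub>M\<^esub> x \<ominus>\<^bsub>M\<^esub> y) \<oplus>\<^bsub>M\<^esub> r \<odot>\<^bsub>M\<^esub> ((b \<ominus> c) \<odot>\<^bsub>M\<^esub> x) = (a \<oplus> r \<otimes> (b \<ominus> c)) \<odot>\<^bsub>M\<^esub> x \<ominus>\<^bsub>M\<^esub> y"
    using a b c r assms(1,3)
    by (simp add: a_minus_def smult_l_distr[of a] smult_assoc1 M.a_ac)
  ultimately show "a \<oplus> r \<otimes> (b \<ominus> c) \<in> {t \<in> carrier R. t \<odot>\<^bsub>M\<^esub> x \<ominus>\<^bsub>M\<^esub> y \<in> K}"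
    using a b c r by (simp add: a_minus_def)
qed auto

lemma affine_closed:
  assumes "affine T" "a \<in> T" "b \<in> T" "c \<in> T" "r \<in> carrier R"
  shows "a \<oplus> r \<otimes> (b \<ominus> c) \<in> T"
  using assms unfolding affine_def by blast

lemma affine_carrier: "affine T \<Longrightarrow> t \<in> T \<Longrightarrow> t \<in> carrier R"
  unfolding affine_def by blast

text \<open>This is the ideal of which \<open>T\<close> is a coset. A base point \<open>a\<close> of
  \<open>T\<close> gives \<open>r (b - c) = (a + r (b - c)) - a\<close>; sums are treated likewise,
  with scalar one.\<close>

lemma ideal_affine_diff:
  assumes "affine T" "T \<noteq> {}"
  shows "ideal {b \<ominus> c | b c. b \<in> T \<and> c \<in> T} R" (is "ideal ?I R")
proof (rule idealI[OF R.ring_axioms])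
  obtain a where a: "a \<in> T" using assms(2) by blast
  note T = affine_carrier[OF assms(1)]
  have closed: "r \<otimes> d \<in> ?I" if "d \<in> ?I" "r \<in> carrier R" for d r
  proof -
    obtain b c where bc: "b \<in> T" "c \<in> T" "d = b \<ominus> c" using \<open>d \<in> ?I\<close> by blast
    have "r \<otimes> d = (a \<oplus> r \<otimes> (b \<ominus> c)) \<ominus> a"
      unfolding bc(3) using T[OF bc(1)] T[OF bc(2)] T[OF a] that(2)
      by (simp add: a_minus_def R.a_ac R.r_neg1 R.r_neg2 R.r_neg)
    then show ?thesis using affine_closed[OF assms(1) a bc(1,2) that(2)] a by blast
  qed
  show "subgroup ?I (add_monoid R)"
  proof (rule R.add.subgroupI)
    show "?I \<subseteq> carrier R" using T by auto
    show "?I \<noteq> {}" using a by blast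
  next
    fix d assume "d \<in> ?I"
    then obtain b c where bc: "b \<in> T" "c \<in> T" "d = b \<ominus> c" by blast
    then have "\<ominus> d = c \<ominus> b" using T by (simp add: a_minus_def R.minus_add R.a_comm)
    then show "\<ominus> d \<in> ?I" using bc by blast
  next
    fix d e assume "d \<in> ?I" "e \<in> ?I"
    then obtain b c b' c' where bc: "b \<in> T" "c \<in> T" "d = b \<ominus> c" "b' \<in> T" "c' \<in> T" "e = b' \<ominus> c'"
      by blast
    have "d \<oplus> e = (b \<oplus> \<one> \<otimes> (b' \<ominus> c')) \<ominus> c"
      unfolding bc(3,6) using T[OF bc(1)] T[OF bc(2)] T[OF bc(4)] T[OF bc(5)]
      by (simp add: a_minus_def R.a_ac)
    then show "d \<oplus> e \<in> ?I"
      using affine_closed[OF assms(1) bc(1,4,5) R.one_closed] bc(2) by blast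
  qed
  fix d r assume "d \<in> ?I" "r \<in> carrier R"
  then show "r \<otimes> d \<in> ?I" by (rule closed)
  moreover have "d \<in> carrier R" using \<open>d \<in> ?I\<close> T by auto
  ultimately show "d \<otimes> r \<in> ?I" using \<open>r \<in> carrier R\<close> by (simp add: R.m_comm)
qed

text \<open>The sets of values \<open>T x\<close> are cosets of the submodules \<open>D T\<close>.
  Where \<open>D T\<close> is minimal, passing to a smaller \<open>U\<close> in \<open>\<F>\<close>
  does not change it, so \<open>U x = T x\<close>; hence any value on \<open>T\<close> is taken on
  every member of the directed family.\<close>

lemma common_value:
  assumes dcc: "wf {(A, B). submodule A R M \<and> submodule B R M \<and> A \<subset> B}"
    and "\<F> \<noteq> {}" and \<F>: "\<And>T. T \<in> \<F> \<Longrightarrow> affine T" "\<And>T. T \<in> \<F> \<Longrightarrow> T \<noteq> {}"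
    and directed: "\<And>S T. S \<in> \<F> \<Longrightarrow> T \<in> \<F> \<Longrightarrow> \<exists>U\<in>\<F>. U \<subseteq> S \<and> U \<subseteq> T"
    and x: "x \<in> carrier M"
  shows "\<exists>y. \<forall>T\<in>\<F>. \<exists>t\<in>T. t \<odot>\<^bsub>M\<^esub> x = y"
proof -
  define D where "D T = (\<lambda>a. a \<odot>\<^bsub>M\<^esub> x) ` {b \<ominus> c | b c. b \<in> T \<and> c \<in> T}" for T
  have D: "submodule (D T) R M" if "T \<in> \<F>" for T
    unfolding D_def by (rule submodule_smult_ideal[OF ideal_affine_diff[OF \<F>(1)[OF that] \<F>(2)[OF that]] x])
  obtain T0 where "T0 \<in> \<F>" using \<open>\<F> \<noteq> {}\<close> by blast
  obtain W where "W \<in> D ` \<F>" and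
    min: "\<And>V. (V, W) \<in> {(A, B). submodule A R M \<and> submodule B R M \<and> A \<subset> B} \<Longrightarrow> V \<notin> D ` \<F>"
    using wfE_min[OF dcc, of "D T0" "D ` \<F>"] \<open>T0 \<in> \<F>\<close> by blast
  then obtain T where T: "T \<in> \<F>" "W = D T" by blast
  obtain t where t: "t \<in> T" using \<F>(2)[OF T(1)] by blast
  have "\<exists>s\<in>S. s \<odot>\<^bsub>M\<^esub> x = t \<odot>\<^bsub>M\<^esub> x" if S: "S \<in> \<F>" for S
  proof -
    obtain U where U: "U \<in> \<F>" "U \<subseteq> T" "U \<subseteq> S" using directed[OF T(1) S] by blast
    note UR = affine_carrier[OF \<F>(1)[OF U(1)]]
    obtain u where u: "u \<in> U" using \<F>(2)[OF U(1)] by blast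
    have "D U \<subseteq> D T" unfolding D_def using U(2) by blast
    then have eq: "D U = D T"
      using min[of "D U"] D[OF U(1)] D[OF T(1)] U(1) unfolding T(2) by auto
    have "(t \<ominus> u) \<odot>\<^bsub>M\<^esub> x \<in> D T" unfolding D_def using t u U(2) by blast
    then obtain b c where bc: "b \<in> U" "c \<in> U" "(t \<ominus> u) \<odot>\<^bsub>M\<^esub> x = (b \<ominus> c) \<odot>\<^bsub>M\<^esub> x"
      unfolding eq[symmetric] unfolding D_def by blast
    have R: "t \<in> carrier R" "u \<in> carrier R" "b \<ominus> c \<in> carrier R"
      using affine_carrier[OF \<F>(1)[OF T(1)] t] UR u bc by auto
    \<comment> \<open>The corrected scalar stays in \<open>U\<close>, thus in \<open>S\<close>, and
      multiplies \<open>x\<close> to the same element as \<open>t\<close>.\<close>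
    have "u \<oplus> \<one> \<otimes> (b \<ominus> c) \<in> S"
      using affine_closed[OF \<F>(1)[OF U(1)] u bc(1,2) R.one_closed] U(3) by blast
    moreover have "(u \<oplus> \<one> \<otimes> (b \<ominus> c)) \<odot>\<^bsub>M\<^esub> x = u \<odot>\<^bsub>M\<^esub> x \<oplus>\<^bsub>M\<^esub> (t \<ominus> u) \<odot>\<^bsub>M\<^esub> x"
      unfolding bc(3) using R x by (simp add: smult_l_distr)
    moreover have "\<dots> = t \<odot>\<^bsub>M\<^esub> x"
      using R x by (simp add: a_minus_def smult_l_distr smult_l_minus M.a_ac M.r_neg1 M.r_neg2 M.r_neg)
    ultimately show ?thesis by metis
  qed
  then show ?thesis by blast
qed

text \<open>
  A maximal family of affine sets with the finite intersection property contains, for each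
  \<open>x\<close>, a fibre of \<open>t \<mapsto> t x\<close>; its value is taken as \<open>s x\<close>.
\<close>

lemma locally_scalar_map:
  assumes dcc: "wf {(A, B). submodule A R M \<and> submodule B R M \<and> A \<subset> B}"
    and aff: "\<And>T. T \<in> \<T> \<Longrightarrow> affine T"
    and fip: "\<And>F. finite F \<Longrightarrow> F \<subseteq> \<T> \<Longrightarrow> carrier R \<inter> \<Inter>F \<noteq> {}"
  obtains s where "\<forall>Y F. finite Y \<longrightarrow> Y \<subseteq> carrier M \<longrightarrow> finite F \<longrightarrow> F \<subseteq> \<T> \<longrightarrow>
    (\<exists>t\<in>carrier R \<inter> \<Inter>F. \<forall>x\<in>Y. s x = t \<odot>\<^bsub>M\<^esub> x)"
proof -
  define \<A> where "\<A> = {\<U>. \<T> \<subseteq> \<U> \<and> (\<forall>T\<in>\<U>. affine T) \<and>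
    (\<forall>F. finite F \<longrightarrow> F \<subseteq> \<U> \<longrightarrow> carrier R \<inter> \<Inter>F \<noteq> {})}"
  have "\<exists>\<U>\<in>\<A>. \<forall>\<V>\<in>\<A>. \<U> \<subseteq> \<V> \<longrightarrow> \<V> = \<U>"
  proof (rule subset_Zorn_nonempty)
    show "\<A> \<noteq> {}" using aff fip unfolding \<A>_def by auto
  next
    fix \<C> assume C: "\<C> \<noteq> {}" "subset.chain \<A> \<C>"
    then have sub: "\<C> \<subseteq> \<A>" unfolding subset_chain_def by simp
    show "\<Union>\<C> \<in> \<A>"
      unfolding \<A>_def
    proof (intro CollectI conjI allI impI)
      show "\<T> \<subseteq> \<Union>\<C>" "\<forall>T\<in>\<Union>\<C>. affine T" using C(1) sub unfolding \<A>_def by blast+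
      fix F assume "finite F" "F \<subseteq> \<Union>\<C>"
      \<comment> \<open>A finite subfamily of the union of a chain lies in a single member, so the
        finite intersection property survives.\<close>
      then obtain B where "B \<in> \<C>" "F \<subseteq> B" by (rule finite_subset_Union_chain[OF _ _ C])
      then show "carrier R \<inter> \<Inter>F \<noteq> {}" using sub \<open>finite F\<close> unfolding \<A>_def by blast
    qed
  qed
  then obtain \<U> where "\<U> \<in> \<A>" and max: "\<And>\<V>. \<V> \<in> \<A> \<Longrightarrow> \<U> \<subseteq> \<V> \<Longrightarrow> \<V> = \<U>" by blast
  then have U: "\<T> \<subseteq> \<U>" "\<And>T. T \<in> \<U> \<Longrightarrow> affine T"
    "\<And>F. finite F \<Longrightarrow> F \<subseteq> \<U> \<Longrightarrow> carrier R \<inter> \<Inter>F \<noteq> {}" unfolding \<A>_def by auto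
  have "\<exists>y. {t \<in> carrier R. t \<odot>\<^bsub>M\<^esub> x = y} \<in> \<U>" if x: "x \<in> carrier M" for x
  proof -
    \<comment> \<open>The finite intersections form a directed family of nonempty affine sets; the
      empty intersection contributes \<open>carrier R\<close>.\<close>
    define \<F> where "\<F> = {carrier R \<inter> \<Inter>F | F. finite F \<and> F \<subseteq> \<U>}"
    have "\<exists>y. \<forall>T\<in>\<F>. \<exists>t\<in>T. t \<odot>\<^bsub>M\<^esub> x = y"
    proof (rule common_value[OF dcc _ _ _ _ x])
      show "\<F> \<noteq> {}" unfolding \<F>_def by blast
      fix T assume "T \<in> \<F>"
      then obtain F where F: "T = carrier R \<inter> \<Inter>F" "finite F" "F \<subseteq> \<U>" unfolding \<F>_def by blast
      show "affine T" unfolding F(1) using F(3) U(2) by (intro affine_Inter) blast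
      show "T \<noteq> {}" unfolding F(1) by (rule U(3)[OF F(2,3)])
      fix S assume "S \<in> \<F>"
      then obtain G where G: "S = carrier R \<inter> \<Inter>G" "finite G" "G \<subseteq> \<U>" unfolding \<F>_def by blast
      show "\<exists>U\<in>\<F>. U \<subseteq> S \<and> U \<subseteq> T"
      proof (intro bexI conjI)
        show "carrier R \<inter> \<Inter>(F \<union> G) \<in> \<F>" unfolding \<F>_def using F G by blast
      qed (use F(1) G(1) in auto)
    qed
    then obtain y where y: "\<And>T. T \<in> \<F> \<Longrightarrow> \<exists>t\<in>T. t \<odot>\<^bsub>M\<^esub> x = y" by blast
    let ?T = "{t \<in> carrier R. t \<odot>\<^bsub>M\<^esub> x = y}"
    have "carrier R \<in> \<F>" unfolding \<F>_def by (rule CollectI, rule exI[of _ "{}"]) simp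
    then have yM: "y \<in> carrier M" using y[of "carrier R"] x by blast
    have "?T = {t \<in> carrier R. t \<odot>\<^bsub>M\<^esub> x \<ominus>\<^bsub>M\<^esub> y \<in> {\<zero>\<^bsub>M\<^esub>}}"
      using x yM by (auto simp: a_minus_def M.r_neg) (metis M.minus_equality M.minus_minus M.a_inv_closed smult_closed)
    then have "affine ?T" using affine_smult_fibre[OF x submodule_zero yM] by simp
    \<comment> \<open>The value \<open>y\<close> is taken on every finite intersection, so adding
      its fibre keeps the finite intersection property; by maximality the fibre is already in
      \<open>\<U>\<close>.\<close>
    have "insert ?T \<U> \<in> \<A>"
      unfolding \<A>_def
    proof (intro CollectI conjI allI impI ballI)
      fix F assume F: "finite F" "F \<subseteq> insert ?T \<U>"
      have "carrier R \<inter> \<Inter>(F - {?T}) \<in> \<F>" unfolding \<F>_def using F by blast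
      then obtain t where "t \<in> carrier R \<inter> \<Inter>(F - {?T})" "t \<odot>\<^bsub>M\<^esub> x = y" using y by blast
      then have "t \<in> carrier R \<inter> \<Inter>F" by blast
      then show "carrier R \<inter> \<Inter>F \<noteq> {}" by blast
    qed (use U \<open>affine ?T\<close> in auto)
    then have "?T \<in> \<U>" using max by blast
    then show ?thesis by blast
  qed
  then obtain s where s: "\<And>x. x \<in> carrier M \<Longrightarrow> {t \<in> carrier R. t \<odot>\<^bsub>M\<^esub> x = s x} \<in> \<U>" by metis
  show thesis
  proof (rule that[of s], intro allI impI)
    fix Y F assume XF: "finite Y" "Y \<subseteq> carrier M" "finite F" "F \<subseteq> \<T>"
    \<comment> \<open>The fibres that prescribe \<open>s\<close> on \<open>Y\<close>, together with
      \<open>F\<close>, are finitely many members of \<open>\<U>\<close>, so one scalar lies in all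
      of them.\<close>
    let ?G = "F \<union> (\<lambda>x. {t \<in> carrier R. t \<odot>\<^bsub>M\<^esub> x = s x}) ` Y"
    have "finite ?G" "?G \<subseteq> \<U>" using XF U(1) s by auto
    then obtain t where "t \<in> carrier R \<inter> \<Inter>?G" using U(3) by blast
    then have t: "\<And>T. T \<in> ?G \<Longrightarrow> t \<in> T" "t \<in> carrier R" by blast+
    have "s x = t \<odot>\<^bsub>M\<^esub> x" if "x \<in> Y" for x
      using t(1)[of "{t \<in> carrier R. t \<odot>\<^bsub>M\<^esub> x = s x}"] that by simp
    moreover have "t \<in> carrier R \<inter> \<Inter>F" using t by simp
    ultimately show "\<exists>t\<in>carrier R \<inter> \<Inter>F. \<forall>x\<in>Y. s x = t \<odot>\<^bsub>M\<^esub> x" by blast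
  qed
qed

end

section \<open>Submodules and quotients of artinian modules\<close>

lemma mod_hom_iff:
  "f \<in> mod_hom R M N \<longleftrightarrow> (\<forall>x\<in>carrier M. f x \<in> carrier N) \<and>
     (\<forall>x\<in>carrier M. \<forall>y\<in>carrier M. f (x \<oplus>\<^bsub>M\<^esub> y) = f x \<oplus>\<^bsub>N\<^esub> f y) \<and>
     (\<forall>r\<in>carrier R. \<forall>x\<in>carrier M. f (r \<odot>\<^bsub>M\<^esub> x) = r \<odot>\<^bsub>N\<^esub> f x)"
  unfolding mod_hom_def hom_def by auto

lemma mod_kernel_eq: "mod_kernel M N f = {x \<in> carrier M. f x = \<zero>\<^bsub>N\<^esub>}"
  unfolding kernel_def by simp

context module
begin

lemma submoduleI':
  assumes "H \<subseteq> carrier M" "\<zero>\<^bsub>M\<^esub> \<in> H"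
    and "\<And>a b. a \<in> H \<Longrightarrow> b \<in> H \<Longrightarrow> a \<oplus>\<^bsub>M\<^esub> b \<in> H"
    and "\<And>r x. r \<in> carrier R \<Longrightarrow> x \<in> H \<Longrightarrow> r \<odot>\<^bsub>M\<^esub> x \<in> H"
  shows "submodule H R M"
proof (rule submoduleI)
  fix a assume a: "a \<in> H"
  then have "a \<in> carrier M" using assms(1) by blast
  then have "\<ominus>\<^bsub>M\<^esub> a = (\<ominus> \<one>) \<odot>\<^bsub>M\<^esub> a" by (simp add: smult_l_minus)
  then show "\<ominus>\<^bsub>M\<^esub> a \<in> H" using assms(4)[OF _ a] by simp
qed (use assms in blast)+

lemma diff_zero:
  assumes "x \<in> carrier M"
  shows "x \<ominus>\<^bsub>M\<^esub> \<zero>\<^bsub>M\<^esub> = x"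
proof -
  have "\<ominus>\<^bsub>M\<^esub> \<zero>\<^bsub>M\<^esub> = \<zero>\<^bsub>M\<^esub>" by (rule M.minus_equality) simp_all
  then show ?thesis unfolding a_minus_def using assms by (simp only: M.r_zero)
qed

lemma submodule_Int:
  assumes A: "submodule A R M" and B: "submodule B R M"
  shows "submodule (A \<inter> B) R M"
proof (rule submoduleI')
  show "A \<inter> B \<subseteq> carrier M" using submoduleD(2)[OF A] by blast
  show "\<zero>\<^bsub>M\<^esub> \<in> A \<inter> B" using submoduleD(1)[OF A] submoduleD(1)[OF B] by simp
qed (simp_all add: submoduleD(3,4)[OF A] submoduleD(3,4)[OF B])

text \<open>Chains of submodules of \<open>A\<close> become chains in \<open>M\<close>, which is how
  \<open>A\<close> inherits the descending chain condition.\<close>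

lemma submodule_sub_iff:
  assumes A: "submodule A R M"
  shows "submodule H R (M\<lparr>carrier := A\<rparr>) \<longleftrightarrow> submodule H R M \<and> H \<subseteq> A"
proof -
  interpret A: module R "M\<lparr>carrier := A\<rparr>"
    by (rule submodule.submodule_is_module[OF A module_axioms])
  show ?thesis
  proof (intro iffI conjI)
    assume H: "submodule H R (M\<lparr>carrier := A\<rparr>)"
    show "H \<subseteq> A" using A.submoduleD(2)[OF H] by auto
    then have "H \<subseteq> carrier M" using submoduleD(2)[OF A] by blast
    then show "submodule H R M"
      by (rule submoduleI') (use A.submoduleD(1,3,4)[OF H] in simp_all)
  next
    assume "submodule H R M \<and> H \<subseteq> A"
    then have H: "submodule H R M" "H \<subseteq> A" by simp_all
    show "submodule H R (M\<lparr>carrier := A\<rparr>)"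
      by (rule A.submoduleI') (use H(2) submoduleD(1,3,4)[OF H(1)] in simp_all)
  qed
qed

text \<open>Here \<open>Q\<close> is a mere record with operations. Every element of its carrier is
  an image, so the axioms are inherited from \<open>M\<close> along \<open>p\<close>; this is how
  quotients on representatives become modules.\<close>

lemma module_image:
  assumes surj: "p ` carrier M = carrier Q" and zero: "p \<zero>\<^bsub>M\<^esub> = \<zero>\<^bsub>Q\<^esub>"
    and add: "\<And>x y. x \<in> carrier M \<Longrightarrow> y \<in> carrier M \<Longrightarrow> p (x \<oplus>\<^bsub>M\<^esub> y) = p x \<oplus>\<^bsub>Q\<^esub> p y"
    and smult: "\<And>r x. r \<in> carrier R \<Longrightarrow> x \<in> carrier M \<Longrightarrow> p (r \<odot>\<^bsub>M\<^esub> x) = r \<odot>\<^bsub>Q\<^esub> p x"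
  shows "module R Q"
proof (rule moduleI)
  have ex: "\<exists>x\<in>carrier M. u = p x" if "u \<in> carrier Q" for u using that surj by blast
  have cl: "p x \<in> carrier Q" if "x \<in> carrier M" for x using that surj by blast
  show "cring R" by (rule R.cring_axioms)
  show "abelian_group Q"
  proof (rule abelian_groupI)
    show "\<zero>\<^bsub>Q\<^esub> \<in> carrier Q" using cl[OF M.zero_closed] zero by simp
  next
    fix u v assume "u \<in> carrier Q" "v \<in> carrier Q"
    then obtain x y where xy: "x \<in> carrier M" "u = p x" "y \<in> carrier M" "v = p y" using ex by metis
    then show "u \<oplus>\<^bsub>Q\<^esub> v \<in> carrier Q" "u \<oplus>\<^bsub>Q\<^esub> v = v \<oplus>\<^bsub>Q\<^esub> u"
      using add[of x y] add[of y x] cl[of "x \<oplus>\<^bsub>M\<^esub> y"] by (simp_all add: M.a_comm)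
    fix w assume "w \<in> carrier Q"
    then obtain z where z: "z \<in> carrier M" "w = p z" using ex by metis
    show "u \<oplus>\<^bsub>Q\<^esub> v \<oplus>\<^bsub>Q\<^esub> w = u \<oplus>\<^bsub>Q\<^esub> (v \<oplus>\<^bsub>Q\<^esub> w)"
      using add[of "x \<oplus>\<^bsub>M\<^esub> y" z] add[of x y] add[of y z] add[of x "y \<oplus>\<^bsub>M\<^esub> z"] xy z
      by (simp add: M.a_assoc)
  next
    fix u assume "u \<in> carrier Q"
    then obtain x where x: "x \<in> carrier M" "u = p x" using ex by metis
    then show "\<zero>\<^bsub>Q\<^esub> \<oplus>\<^bsub>Q\<^esub> u = u" using add[of "\<zero>\<^bsub>M\<^esub>" x] zero by simp
    show "\<exists>v\<in>carrier Q. v \<oplus>\<^bsub>Q\<^esub> u = \<zero>\<^bsub>Q\<^esub>"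
      using add[of "\<ominus>\<^bsub>M\<^esub> x" x] x zero cl[of "\<ominus>\<^bsub>M\<^esub> x"]
      by (intro bexI[of _ "p (\<ominus>\<^bsub>M\<^esub> x)"]) (simp_all add: M.l_neg)
  qed
  fix u assume "u \<in> carrier Q"
  then obtain x where x: "x \<in> carrier M" "u = p x" using ex by metis
  show "\<one> \<odot>\<^bsub>Q\<^esub> u = u" using smult[of \<one> x] x by simp
  fix a assume a: "a \<in> carrier R"
  show "a \<odot>\<^bsub>Q\<^esub> u \<in> carrier Q" using smult[of a x] a x cl[of "a \<odot>\<^bsub>M\<^esub> x"] by simp
  {
    fix v assume "v \<in> carrier Q"
    then obtain y where y: "y \<in> carrier M" "v = p y" using ex by metis
    show "a \<odot>\<^bsub>Q\<^esub> (u \<oplus>\<^bsub>Q\<^esub> v) = a \<odot>\<^bsub>Q\<^esub> u \<oplus>\<^bsub>Q\<^esub> a \<odot>\<^bsub>Q\<^esub> v"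
      using smult[of a "x \<oplus>\<^bsub>M\<^esub> y"] smult[of a x] smult[of a y] add[of x y]
        add[of "a \<odot>\<^bsub>M\<^esub> x" "a \<odot>\<^bsub>M\<^esub> y"] a x y by (simp add: smult_r_distr)
  }
  fix b assume b: "b \<in> carrier R"
  show "(a \<oplus> b) \<odot>\<^bsub>Q\<^esub> u = a \<odot>\<^bsub>Q\<^esub> u \<oplus>\<^bsub>Q\<^esub> b \<odot>\<^bsub>Q\<^esub> u"
    using smult[of "a \<oplus> b" x] smult[of a x] smult[of b x] add[of "a \<odot>\<^bsub>M\<^esub> x" "b \<odot>\<^bsub>M\<^esub> x"] a b x
    by (simp add: smult_l_distr)
  show "(a \<otimes> b) \<odot>\<^bsub>Q\<^esub> u = a \<odot>\<^bsub>Q\<^esub> (b \<odot>\<^bsub>Q\<^esub> u)"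
    using smult[of "a \<otimes> b" x] smult[of a "b \<odot>\<^bsub>M\<^esub> x"] smult[of b x] a b x
    by (simp add: smult_assoc1)
qed

end

lemma artinian_submodule:
  assumes M: "artinian_module R M" and A: "submodule A R M"
  shows "artinian_module R (M\<lparr>carrier := A\<rparr>)"
proof -
  interpret module R M using M unfolding artinian_module_def by simp
  have "module R (M\<lparr>carrier := A\<rparr>)" by (rule submodule.submodule_is_module[OF A module_axioms])
  then show ?thesis
    using M unfolding artinian_module_def submodule_sub_iff[OF A] by simp
qed

text \<open>A descending chain in \<open>Q\<close> is pulled back to \<open>M\<close>, where it
  becomes stationary; surjectivity recovers each member as the image of its preimage.\<close>

lemma artinian_image:
  assumes M: "artinian_module R M" and Q: "module R Q" and p: "p \<in> mod_hom R M Q"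
    and p_zero: "p \<zero>\<^bsub>M\<^esub> = \<zero>\<^bsub>Q\<^esub>" and p_surj: "p ` carrier M = carrier Q"
  shows "artinian_module R Q"
proof -
  have modM: "module R M" using M unfolding artinian_module_def by (rule conjunct1)
  have "\<exists>k. \<forall>n\<ge>k. N n = N k"
    if N: "\<And>n. submodule (N n) R Q" "\<And>n. N (Suc n) \<subseteq> N n" for N :: "nat \<Rightarrow> _"
  proof -
    define L where "L n = {x \<in> carrier M. p x \<in> N n}" for n
    have "submodule (L n) R M" for n
    proof (rule module.submoduleI'[OF modM])
      note Nn = module.submoduleD[OF Q N(1)[of n]]
      show "\<zero>\<^bsub>M\<^esub> \<in> L n"
        unfolding L_def using p_zero Nn(1) abelian_groupE(2)[OF module.axioms(2)[OF modM]] by simp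
      fix a assume a: "a \<in> L n"
      {
        fix b assume "b \<in> L n"
        then show "a \<oplus>\<^bsub>M\<^esub> b \<in> L n"
          using a p[unfolded mod_hom_iff] Nn(3)[of "p a" "p b"]
            abelian_groupE(1)[OF module.axioms(2)[OF modM]]
          unfolding L_def by simp
      }
      fix r assume "r \<in> carrier R"
      then show "r \<odot>\<^bsub>M\<^esub> a \<in> L n"
        using a p[unfolded mod_hom_iff] Nn(4)[of r "p a"] module.smult_closed[OF modM, of r a]
        unfolding L_def by simp
    qed (auto simp: L_def)
    moreover have "L (Suc n) \<subseteq> L n" for n unfolding L_def using N(2)[of n] by auto
    ultimately obtain k where k: "\<forall>n\<ge>k. L n = L k"
      using M[unfolded artinian_module_def, THEN conjunct2, rule_format, of L] by auto
    have im: "N n = p ` L n" for n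
    proof
      show "p ` L n \<subseteq> N n" unfolding L_def by auto
      show "N n \<subseteq> p ` L n"
      proof
        fix u assume u: "u \<in> N n"
        then have "u \<in> p ` carrier M"
          unfolding p_surj by (rule module.submoduleD(2)[OF Q N(1)])
        then show "u \<in> p ` L n" using u unfolding L_def by auto
      qed
    qed
    have "N n = N k" if "k \<le> n" for n
      unfolding im k[rule_format, OF that] ..
    then show ?thesis by blast
  qed
  then show ?thesis using Q unfolding artinian_module_def by simp
qed

text \<open>
  The quotient of \<open>A\<close> by \<open>B\<close>, for submodules \<open>B \<subseteq> A\<close> of \<open>M\<close>, realised on representatives of
  the cosets, so that the type of the elements does not change.
\<close>

definition coset_rep :: "('a, 'b) module \<Rightarrow> 'b set \<Rightarrow> 'b \<Rightarrow> 'b" where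
  "coset_rep M B x = (SOME y. \<exists>b\<in>B. y = x \<oplus>\<^bsub>M\<^esub> b)"

definition quot_module :: "('a, 'b) module \<Rightarrow> 'b set \<Rightarrow> 'b set \<Rightarrow> ('a, 'b) module" where
  "quot_module M A B = M\<lparr>carrier := coset_rep M B ` A, zero := coset_rep M B \<zero>\<^bsub>M\<^esub>,
     add := \<lambda>x y. coset_rep M B (x \<oplus>\<^bsub>M\<^esub> y), smult := \<lambda>r x. coset_rep M B (r \<odot>\<^bsub>M\<^esub> x)\<rparr>"

locale artinian = module R M for R :: "('a, 'm) ring_scheme" (structure) and M :: "('a, 'b) module" +
  assumes art: "artinian_module R M"
begin

abbreviation sub :: "'b set \<Rightarrow> ('a, 'b) module" where
  "sub A \<equiv> M\<lparr>carrier := A\<rparr>"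

context
  fixes B assumes B: "submodule B R M"
begin

lemma coset_rep_diff:
  assumes "x \<in> carrier M"
  shows "coset_rep M B x \<in> carrier M" "coset_rep M B x \<ominus>\<^bsub>M\<^esub> x \<in> B"
proof -
  note B = submoduleD[OF B]
  have "\<exists>b\<in>B. coset_rep M B x = x \<oplus>\<^bsub>M\<^esub> b"
    unfolding coset_rep_def by (rule someI_ex) (use B(1) in blast)
  then obtain b where b: "b \<in> B" "coset_rep M B x = x \<oplus>\<^bsub>M\<^esub> b" by blast
  then show "coset_rep M B x \<in> carrier M" using assms B(2) by simp
  show "coset_rep M B x \<ominus>\<^bsub>M\<^esub> x \<in> B"
    unfolding b(2) using b(1) assms B(2)[OF b(1)] by (simp add: a_minus_def M.a_ac M.r_neg1 M.r_neg2 M.r_neg)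
qed

lemma coset_rep_eq_iff:
  assumes x: "x \<in> carrier M" and y: "y \<in> carrier M"
  shows "coset_rep M B x = coset_rep M B y \<longleftrightarrow> x \<ominus>\<^bsub>M\<^esub> y \<in> B"
proof
  note B = submoduleD[OF B]
  assume eq: "coset_rep M B x = coset_rep M B y"
  have "(coset_rep M B y \<ominus>\<^bsub>M\<^esub> y) \<ominus>\<^bsub>M\<^esub> (coset_rep M B x \<ominus>\<^bsub>M\<^esub> x) \<in> B"
    by (intro B(6) coset_rep_diff(2) x y)
  then show "x \<ominus>\<^bsub>M\<^esub> y \<in> B"
    unfolding eq using coset_rep_diff(1)[OF y] x y
    by (simp add: a_minus_def M.minus_add M.a_ac M.r_neg1 M.r_neg2 M.r_neg)
next
  note B = submoduleD[OF B]
  assume d: "x \<ominus>\<^bsub>M\<^esub> y \<in> B"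
  \<comment> \<open>Both representatives are chosen from the same coset: \<open>SOME\<close> is
    applied to equivalent predicates, so the choices coincide.\<close>
  have "(\<exists>b\<in>B. u = x \<oplus>\<^bsub>M\<^esub> b) \<longleftrightarrow> (\<exists>b\<in>B. u = y \<oplus>\<^bsub>M\<^esub> b)" for u
  proof
    assume "\<exists>b\<in>B. u = x \<oplus>\<^bsub>M\<^esub> b"
    then obtain b where b: "b \<in> B" "u = x \<oplus>\<^bsub>M\<^esub> b" by blast
    have "u = y \<oplus>\<^bsub>M\<^esub> ((x \<ominus>\<^bsub>M\<^esub> y) \<oplus>\<^bsub>M\<^esub> b)"
      unfolding b(2) using x y B(2)[OF b(1)] by (simp add: a_minus_def M.a_ac M.r_neg1 M.r_neg2 M.r_neg)
    then show "\<exists>b\<in>B. u = y \<oplus>\<^bsub>M\<^esub> b" using B(3)[OF d b(1)] by blast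
  next
    assume "\<exists>b\<in>B. u = y \<oplus>\<^bsub>M\<^esub> b"
    then obtain b where b: "b \<in> B" "u = y \<oplus>\<^bsub>M\<^esub> b" by blast
    have "b \<ominus>\<^bsub>M\<^esub> (x \<ominus>\<^bsub>M\<^esub> y) = \<ominus>\<^bsub>M\<^esub> x \<oplus>\<^bsub>M\<^esub> (y \<oplus>\<^bsub>M\<^esub> b)"
      using x y B(2)[OF b(1)] by (simp add: a_minus_def M.minus_add M.a_ac)
    then have "u = x \<oplus>\<^bsub>M\<^esub> (b \<ominus>\<^bsub>M\<^esub> (x \<ominus>\<^bsub>M\<^esub> y))"
      unfolding b(2) using x y B(2)[OF b(1)] by (simp add: M.r_neg2)
    then show "\<exists>b\<in>B. u = x \<oplus>\<^bsub>M\<^esub> b" using B(6)[OF b(1) d] by blast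
  qed
  then show "coset_rep M B x = coset_rep M B y" unfolding coset_rep_def by simp
qed

lemma coset_rep_zero_iff:
  assumes "x \<in> carrier M"
  shows "coset_rep M B x = coset_rep M B \<zero>\<^bsub>M\<^esub> \<longleftrightarrow> x \<in> B"
  using coset_rep_eq_iff[OF assms M.zero_closed] diff_zero[OF assms] by (simp only:)

lemma coset_rep_add:
  assumes x: "x \<in> carrier M" and y: "y \<in> carrier M"
  shows "coset_rep M B (coset_rep M B x \<oplus>\<^bsub>M\<^esub> coset_rep M B y) = coset_rep M B (x \<oplus>\<^bsub>M\<^esub> y)"
proof -
  have "(coset_rep M B x \<ominus>\<^bsub>M\<^esub> x) \<oplus>\<^bsub>M\<^esub> (coset_rep M B y \<ominus>\<^bsub>M\<^esub> y) \<in> B"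
    by (intro submoduleD(3)[OF B] coset_rep_diff x y)
  then have "(coset_rep M B x \<oplus>\<^bsub>M\<^esub> coset_rep M B y) \<ominus>\<^bsub>M\<^esub> (x \<oplus>\<^bsub>M\<^esub> y) \<in> B"
    using coset_rep_diff(1)[OF x] coset_rep_diff(1)[OF y] x y
    by (simp add: a_minus_def M.minus_add M.a_ac)
  then show ?thesis using coset_rep_diff(1)[OF x] coset_rep_diff(1)[OF y] x y by (simp add: coset_rep_eq_iff)
qed

lemma coset_rep_smult:
  assumes r: "r \<in> carrier R" and x: "x \<in> carrier M"
  shows "coset_rep M B (r \<odot>\<^bsub>M\<^esub> coset_rep M B x) = coset_rep M B (r \<odot>\<^bsub>M\<^esub> x)"
proof -
  have "r \<odot>\<^bsub>M\<^esub> (coset_rep M B x \<ominus>\<^bsub>M\<^esub> x) \<in> B"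
    by (intro submoduleD(4)[OF B] coset_rep_diff x r)
  then have "r \<odot>\<^bsub>M\<^esub> coset_rep M B x \<ominus>\<^bsub>M\<^esub> r \<odot>\<^bsub>M\<^esub> x \<in> B"
    using coset_rep_diff(1)[OF x] x r by (simp add: a_minus_def smult_r_distr smult_r_minus)
  then show ?thesis using coset_rep_diff(1)[OF x] x r by (simp add: coset_rep_eq_iff)
qed

lemma quot_module:
  assumes A: "submodule A R M"
  shows "module R (quot_module M A B)"
    and "artinian_module R (quot_module M A B)"
    and "coset_rep M B \<in> mod_hom R (sub A) (quot_module M A B)"
proof -
  note AM = submoduleD(2)[OF A]
  interpret A: module R "sub A" by (rule submodule.submodule_is_module[OF A module_axioms])
  show m: "module R (quot_module M A B)"
    by (rule A.module_image[where p = "coset_rep M B"])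
      (simp_all add: quot_module_def coset_rep_add coset_rep_smult AM)
  show hom: "coset_rep M B \<in> mod_hom R (sub A) (quot_module M A B)"
    unfolding mod_hom_iff by (simp add: quot_module_def coset_rep_add coset_rep_smult AM)
  show "artinian_module R (quot_module M A B)"
    by (rule artinian_image[OF artinian_submodule[OF art A] m hom]) (simp_all add: quot_module_def)
qed

end

end

section \<open>Wide subcategories\<close>

locale wide_in_artinian = artinian +
  fixes C :: "('a, 'c) module set"
  assumes wide: "wide_subcategory R C"
begin

section \<open>Closure properties for submodules of a fixed module\<close>

definition inC :: "'c set \<Rightarrow> bool" where
  "inC A \<longleftrightarrow> submodule A R M \<and> sub A \<in> C"

lemma sub_Art: "submodule A R M \<Longrightarrow> sub A \<in> Art R"
  unfolding Art_def using artinian_submodule[OF art] by simp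

text \<open>The quotient is the cokernel of the inclusion, which is the map
  \<open>id\<close>.\<close>

lemma quot_in_C:
  assumes "inC A" "inC B" "B \<subseteq> A"
  shows "quot_module M A B \<in> C"
proof -
  have A: "submodule A R M" "sub A \<in> C" and B: "submodule B R M" "sub B \<in> C"
    using assms unfolding inC_def by simp_all
  have "id \<in> mod_hom R (sub B) (sub A)" unfolding mod_hom_iff using assms(3) by auto
  moreover have "is_cokernel R (sub B) (sub A) id (quot_module M A B) (coset_rep M B)"
    unfolding is_cokernel_def mod_kernel_eq
    using quot_module(3)[OF B(1) A(1)] assms(3) coset_rep_zero_iff[OF B(1) submoduleD(2)[OF A(1)]]
    by (auto simp: quot_module_def)
  moreover have "quot_module M A B \<in> Art R" unfolding Art_def using quot_module(2)[OF B(1) A(1)] by simp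
  ultimately show ?thesis
    using wide A(2) B(2) unfolding wide_subcategory_def closed_under_cokernels_def by blast
qed

text \<open>The map \<open>g\<close> is linear modulo \<open>B\<close>, and \<open>D\<close> is the
  kernel of the homomorphism from \<open>A\<close> to \<open>A/B\<close> that it induces. This form
  covers an endomorphism as well as a projection given by chosen components.\<close>

lemma kernel_inC:
  assumes "inC A" "inC B" "B \<subseteq> A" and D: "submodule D R M"
    and D_eq: "D = {x \<in> A. g x \<in> B}"
    and g: "\<And>x. x \<in> A \<Longrightarrow> g x \<in> A"
      "\<And>x y. x \<in> A \<Longrightarrow> y \<in> A \<Longrightarrow> g (x \<oplus>\<^bsub>M\<^esub> y) \<ominus>\<^bsub>M\<^esub> (g x \<oplus>\<^bsub>M\<^esub> g y) \<in> B"
      "\<And>r x. r \<in> carrier R \<Longrightarrow> x \<in> A \<Longrightarrow> g (r \<odot>\<^bsub>M\<^esub> x) \<ominus>\<^bsub>M\<^esub> r \<odot>\<^bsub>M\<^esub> g x \<in> B"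
  shows "inC D"
proof -
  have A: "submodule A R M" "sub A \<in> C" and B: "submodule B R M" "sub B \<in> C"
    using assms unfolding inC_def by simp_all
  note Ad = submoduleD[OF A(1)]
  let ?Q = "quot_module M A B" and ?f = "\<lambda>x. coset_rep M B (g x)"
  have hom: "?f \<in> mod_hom R (sub A) ?Q"
    unfolding mod_hom_iff
  proof (intro conjI ballI)
    fix x assume "x \<in> carrier (sub A)"
    then have x: "x \<in> A" by simp
    then show "?f x \<in> carrier ?Q" using g(1) by (simp add: quot_module_def)
    {
      fix y assume "y \<in> carrier (sub A)"
      then have y: "y \<in> A" by simp
      have "?f (x \<oplus>\<^bsub>M\<^esub> y) = coset_rep M B (g x \<oplus>\<^bsub>M\<^esub> g y)"
        using g(1,2) x y Ad(2,3) coset_rep_eq_iff[OF B(1), of "g (x \<oplus>\<^bsub>M\<^esub> y)" "g x \<oplus>\<^bsub>M\<^esub> g y"] by simp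
      then show "?f (x \<oplus>\<^bsub>sub A\<^esub> y) = ?f x \<oplus>\<^bsub>?Q\<^esub> ?f y"
        using coset_rep_add[OF B(1), of "g x" "g y"] g(1) x y Ad(2) by (simp add: quot_module_def)
    }
    fix r assume r: "r \<in> carrier R"
    have "?f (r \<odot>\<^bsub>M\<^esub> x) = coset_rep M B (r \<odot>\<^bsub>M\<^esub> g x)"
      using g(1,3) x r Ad(2,4) coset_rep_eq_iff[OF B(1), of "g (r \<odot>\<^bsub>M\<^esub> x)" "r \<odot>\<^bsub>M\<^esub> g x"] by simp
    then show "?f (r \<odot>\<^bsub>sub A\<^esub> x) = r \<odot>\<^bsub>?Q\<^esub> ?f x"
      using coset_rep_smult[OF B(1) r, of "g x"] g(1) x Ad(2) by (simp add: quot_module_def)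
  qed
  have id: "id \<in> mod_hom R (sub D) (sub A)" unfolding mod_hom_iff D_eq by auto
  have "is_kernel R (sub A) ?Q ?f (sub D) id"
    unfolding is_kernel_def mod_kernel_eq
  proof (intro conjI id)
    show "id ` carrier (sub D) = {x \<in> carrier (sub A). ?f x = \<zero>\<^bsub>?Q\<^esub>}"
      unfolding D_eq using coset_rep_zero_iff[OF B(1) Ad(2)[OF g(1)]] by (auto simp: quot_module_def)
  qed simp
  then show ?thesis
    using wide A(2) quot_in_C[OF assms(1-3)] hom sub_Art[OF D] D
    unfolding wide_subcategory_def closed_under_kernels_def inC_def by blast
qed

lemma extension_inC:
  assumes A: "submodule A R M" and "inC B" "B \<subseteq> A" and Q: "quot_module M A B \<in> C"
  shows "inC A"
proof -
  have B: "submodule B R M" "sub B \<in> C"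
    using assms unfolding inC_def by simp_all
  have "short_exact R (sub B) id (sub A) (coset_rep M B) (quot_module M A B)"
    unfolding short_exact_def mod_kernel_eq
  proof (intro conjI quot_module(3)[OF B(1) A])
    show "id \<in> mod_hom R (sub B) (sub A)" unfolding mod_hom_iff using assms(3) by auto
    show "id ` carrier (sub B) = {x \<in> carrier (sub A). coset_rep M B x = \<zero>\<^bsub>quot_module M A B\<^esub>}"
      using assms(3) coset_rep_zero_iff[OF B(1) submoduleD(2)[OF A]] by (auto simp: quot_module_def)
  qed (simp_all add: quot_module_def)
  then show ?thesis
    using wide B(2) Q sub_Art[OF A] A
    unfolding wide_subcategory_def closed_under_extensions_def inC_def by blast
qed

text \<open>The zero module is the kernel of an identity map.\<close>

lemma inC_zero:
  assumes "inC A"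
  shows "inC {\<zero>\<^bsub>M\<^esub>}"
proof -
  have A: "submodule A R M" "sub A \<in> C" using assms unfolding inC_def by simp_all
  have "id \<in> mod_hom R (sub A) (sub A)" unfolding mod_hom_iff by auto
  moreover have "is_kernel R (sub A) (sub A) id (sub {\<zero>\<^bsub>M\<^esub>}) id"
    unfolding is_kernel_def mod_kernel_eq mod_hom_iff using submoduleD(1)[OF A(1)] by auto
  ultimately show ?thesis
    using wide A(2) sub_Art[OF submodule_zero] submodule_zero
    unfolding wide_subcategory_def closed_under_kernels_def inC_def by blast
qed

section \<open>Extremal submodules and locally scalar maps\<close>

text \<open>Zorn's lemma gives \<open>K\<close>, since the union of a chain of submodules avoiding
  \<open>z\<close> avoids \<open>z\<close>. The last property says that in \<open>M/K\<close> the
  class of \<open>z\<close> is a multiple of every nonzero element, so it generates a simple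
  essential socle.\<close>

lemma maximal_submodule_avoiding:
  assumes z: "z \<noteq> \<zero>\<^bsub>M\<^esub>" "z \<in> carrier M"
  obtains K where "submodule K R M" "z \<notin> K"
    "\<And>v. v \<in> carrier M \<Longrightarrow> v \<notin> K \<Longrightarrow> \<exists>a\<in>carrier R. a \<odot>\<^bsub>M\<^esub> v \<ominus>\<^bsub>M\<^esub> z \<in> K"
proof -
  define \<H> where "\<H> = {K. submodule K R M \<and> z \<notin> K}"
  have "\<exists>K\<in>\<H>. \<forall>L\<in>\<H>. K \<subseteq> L \<longrightarrow> L = K"
  proof (rule subset_Zorn_nonempty)
    show "\<H> \<noteq> {}" unfolding \<H>_def using submodule_zero z by blast
  next
    fix \<C> assume C: "\<C> \<noteq> {}" "subset.chain \<H> \<C>"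
    then have sub: "\<And>A. A \<in> \<C> \<Longrightarrow> submodule A R M" "\<And>A. A \<in> \<C> \<Longrightarrow> z \<notin> A"
      and chain: "\<And>A B. A \<in> \<C> \<Longrightarrow> B \<in> \<C> \<Longrightarrow> A \<subseteq> B \<or> B \<subseteq> A"
      unfolding subset_chain_def \<H>_def by auto
    have "submodule (\<Union>\<C>) R M"
    proof (rule submoduleI')
      show "\<Union>\<C> \<subseteq> carrier M" using submoduleD(2)[OF sub(1)] by (intro subsetI) auto
      show "\<zero>\<^bsub>M\<^esub> \<in> \<Union>\<C>" using submoduleD(1)[OF sub(1)] C(1) by (auto simp: ex_in_conv[symmetric])
      fix a assume "a \<in> \<Union>\<C>"
      then obtain A where A: "A \<in> \<C>" "a \<in> A" ..
      {
        fix b assume "b \<in> \<Union>\<C>"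
        then obtain B where B: "B \<in> \<C>" "b \<in> B" ..
        from chain[OF A(1) B(1)] show "a \<oplus>\<^bsub>M\<^esub> b \<in> \<Union>\<C>"
        proof
          assume "A \<subseteq> B"
          then show ?thesis using submoduleD(3)[OF sub(1)[OF B(1)], of a b] A B by (intro UnionI[OF B(1)]) auto
        next
          assume "B \<subseteq> A"
          then show ?thesis using submoduleD(3)[OF sub(1)[OF A(1)], of a b] A B by (intro UnionI[OF A(1)]) auto
        qed
      }
      fix r assume "r \<in> carrier R"
      then show "r \<odot>\<^bsub>M\<^esub> a \<in> \<Union>\<C>"
        using submoduleD(4)[OF sub(1)[OF A(1)], of r a] A by (intro UnionI[OF A(1)]) simp
    qed
    then show "\<Union>\<C> \<in> \<H>" unfolding \<H>_def using sub(2) by simp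
  qed
  then obtain K where "K \<in> \<H>" and max: "\<And>L. L \<in> \<H> \<Longrightarrow> K \<subseteq> L \<Longrightarrow> L = K" by blast
  then have K: "submodule K R M" "z \<notin> K" unfolding \<H>_def by simp_all
  note Kd = submoduleD[OF K(1)]
  have "\<exists>a\<in>carrier R. a \<odot>\<^bsub>M\<^esub> v \<ominus>\<^bsub>M\<^esub> z \<in> K" if v: "v \<in> carrier M" "v \<notin> K" for v
  proof -
    \<comment> \<open>This is \<open>K + R v\<close>, which properly contains \<open>K\<close> and
      so contains \<open>z\<close> by maximality.\<close>
    define L where "L = {k \<oplus>\<^bsub>M\<^esub> a \<odot>\<^bsub>M\<^esub> v | k a. k \<in> K \<and> a \<in> carrier R}"
    have L_I: "k \<oplus>\<^bsub>M\<^esub> a \<odot>\<^bsub>M\<^esub> v \<in> L" if "k \<in> K" "a \<in> carrier R" for k a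
      unfolding L_def using that by blast
    have "submodule L R M"
    proof (rule submoduleI')
      show "L \<subseteq> carrier M" unfolding L_def using Kd(2) v by auto
      show "\<zero>\<^bsub>M\<^esub> \<in> L" using L_I[OF Kd(1) R.zero_closed] v by simp
      fix x assume "x \<in> L"
      then obtain k a where x: "k \<in> K" "a \<in> carrier R" "x = k \<oplus>\<^bsub>M\<^esub> a \<odot>\<^bsub>M\<^esub> v" unfolding L_def by blast
      note kM = Kd(2)[OF x(1)]
      {
        fix y assume "y \<in> L"
        then obtain l b where y: "l \<in> K" "b \<in> carrier R" "y = l \<oplus>\<^bsub>M\<^esub> b \<odot>\<^bsub>M\<^esub> v" unfolding L_def by blast
        have "x \<oplus>\<^bsub>M\<^esub> y = (k \<oplus>\<^bsub>M\<^esub> l) \<oplus>\<^bsub>M\<^esub> (a \<oplus> b) \<odot>\<^bsub>M\<^esub> v"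
          unfolding x(3) y(3) using x(2) y(2) v(1) kM Kd(2)[OF y(1)] by (simp add: smult_l_distr M.a_ac)
        then show "x \<oplus>\<^bsub>M\<^esub> y \<in> L" using L_I[OF Kd(3)[OF x(1) y(1)], of "a \<oplus> b"] x(2) y(2) by simp
      }
      fix r assume r: "r \<in> carrier R"
      have "r \<odot>\<^bsub>M\<^esub> x = r \<odot>\<^bsub>M\<^esub> k \<oplus>\<^bsub>M\<^esub> (r \<otimes> a) \<odot>\<^bsub>M\<^esub> v"
        unfolding x(3) using x(2) r v(1) kM by (simp add: smult_r_distr smult_assoc1)
      then show "r \<odot>\<^bsub>M\<^esub> x \<in> L" using L_I[OF Kd(4)[OF r x(1)], of "r \<otimes> a"] x(2) r by simp
    qed
    moreover have "K \<subseteq> L"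
    proof
      fix k assume "k \<in> K"
      then show "k \<in> L" using L_I[OF _ R.zero_closed, of k] v(1) Kd(2) by simp
    qed
    moreover have "v \<in> L" using L_I[OF Kd(1) R.one_closed] v(1) by simp
    ultimately have "L \<notin> \<H>" "submodule L R M" using max v(2) by blast+
    then have "z \<in> L" unfolding \<H>_def by simp
    then obtain k a where ka: "k \<in> K" "a \<in> carrier R" "z = k \<oplus>\<^bsub>M\<^esub> a \<odot>\<^bsub>M\<^esub> v" unfolding L_def by blast
    have "a \<odot>\<^bsub>M\<^esub> v \<ominus>\<^bsub>M\<^esub> z = \<ominus>\<^bsub>M\<^esub> k"
      unfolding ka(3) using ka(2) v(1) Kd(2)[OF ka(1)]
      by (simp add: a_minus_def M.minus_add M.a_lcomm M.r_neg)
    then show ?thesis using Kd(5)[OF ka(1)] ka(2) by metis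
  qed
  then show thesis using that K by blast
qed

lemma minimal_inC_over:
  assumes "inC (carrier M)" "N \<subseteq> carrier M"
  obtains M0 where "inC M0" "N \<subseteq> M0" "\<And>A. inC A \<Longrightarrow> N \<subseteq> A \<Longrightarrow> A \<subseteq> M0 \<Longrightarrow> A = M0"
proof -
  obtain M0 where M0: "M0 \<in> {A. inC A \<and> N \<subseteq> A}" and
    min: "\<And>A. (A, M0) \<in> {(A, B). submodule A R M \<and> submodule B R M \<and> A \<subset> B} \<Longrightarrow>
      A \<notin> {A. inC A \<and> N \<subseteq> A}"
    using wfE_min[OF artinian_wf[OF art], of "carrier M" "{A. inC A \<and> N \<subseteq> A}"] assms by blast
  show thesis
  proof (rule that[of M0])
    fix A assume A: "inC A" "N \<subseteq> A" "A \<subseteq> M0"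
    then have "(A, M0) \<notin> {(A, B). submodule A R M \<and> submodule B R M \<and> A \<subset> B}" using min by blast
    then show "A = M0" using A(1,3) M0 unfolding inC_def by blast
  qed (use M0 in auto)
qed

definition locally_scalar :: "('c \<Rightarrow> 'c) \<Rightarrow> bool" where
  "locally_scalar s \<longleftrightarrow> (\<forall>Y. finite Y \<longrightarrow> Y \<subseteq> carrier M \<longrightarrow> (\<exists>t\<in>carrier R. \<forall>y\<in>Y. s y = t \<odot>\<^bsub>M\<^esub> y))"

text \<open>
  Elements of \<open>R\<close> multiplying \<open>N\<close> into \<open>K\<close> and \<open>x\<close> onto \<open>z\<close> modulo \<open>K\<close> exist for finite
  subsets of \<open>N\<close>, because \<open>M/K\<close> has a simple essential socle; linear compactness glues them.
\<close>

lemma separating_locally_scalar_map: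
  assumes noeth: "noetherian_ring R" and N: "submodule N R M" and K: "submodule K R M"
    and z: "z \<in> carrier M" "z \<notin> K"
    and essential: "\<And>v. v \<in> carrier M \<Longrightarrow> v \<notin> K \<Longrightarrow> \<exists>a\<in>carrier R. a \<odot>\<^bsub>M\<^esub> v \<ominus>\<^bsub>M\<^esub> z \<in> K"
    and x: "x \<in> carrier M" "\<And>n. n \<in> N \<Longrightarrow> x \<ominus>\<^bsub>M\<^esub> n \<notin> K"
  obtains s where
    "locally_scalar s" "\<And>n. n \<in> N \<Longrightarrow> s n \<in> K" "s x \<ominus>\<^bsub>M\<^esub> z \<in> K"
proof -
  let ?Q = "quot_module M (carrier M) K" and ?q = "coset_rep M K"
  note Nd = submoduleD[OF N]
  note Q = quot_module[OF K carrier_is_submodule]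
  interpret Q: module R ?Q by (rule Q(1))
  note q_zero = coset_rep_zero_iff[OF K] and q_eq = coset_rep_eq_iff[OF K]
  have Q_zero: "\<zero>\<^bsub>?Q\<^esub> = ?q \<zero>\<^bsub>M\<^esub>" by (simp add: quot_module_def)
  have q_smult: "a \<odot>\<^bsub>?Q\<^esub> ?q v = ?q (a \<odot>\<^bsub>M\<^esub> v)" if "a \<in> carrier R" "v \<in> carrier M" for a v
    using coset_rep_smult[OF K that] by (simp add: quot_module_def)
  have q_add: "?q u \<oplus>\<^bsub>?Q\<^esub> ?q v = ?q (u \<oplus>\<^bsub>M\<^esub> v)" if "u \<in> carrier M" "v \<in> carrier M" for u v
    using coset_rep_add[OF K that] by (simp add: quot_module_def)
  have q_closed: "?q v \<in> carrier ?Q" if "v \<in> carrier M" for v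
    using that by (simp add: quot_module_def)
  have q_z: "?q z \<in> carrier ?Q" "?q z \<noteq> \<zero>\<^bsub>?Q\<^esub>"
    using q_zero[OF z(1)] z(2) q_closed[OF z(1)] by (simp_all add: Q_zero)
  have socle: "\<exists>a\<in>carrier R. a \<odot>\<^bsub>?Q\<^esub> w = ?q z" if w: "w \<in> carrier ?Q" "w \<noteq> \<zero>\<^bsub>?Q\<^esub>" for w
  proof -
    obtain v where v: "v \<in> carrier M" "w = ?q v" using w(1) by (auto simp: quot_module_def)
    then have "v \<notin> K" using w(2) q_zero[OF v(1)] unfolding Q_zero by simp
    then obtain a where a: "a \<in> carrier R" "a \<odot>\<^bsub>M\<^esub> v \<ominus>\<^bsub>M\<^esub> z \<in> K" using essential v(1) by blast
    then have "?q (a \<odot>\<^bsub>M\<^esub> v) = ?q z" using q_eq[of "a \<odot>\<^bsub>M\<^esub> v" z] v(1) z(1) by simp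
    then show ?thesis using a(1) v q_smult by auto
  qed
  have qN: "submodule (?q ` N) R ?Q"
  proof (rule Q.submoduleI')
    show "?q ` N \<subseteq> carrier ?Q" using q_closed Nd(2) by auto
    show "\<zero>\<^bsub>?Q\<^esub> \<in> ?q ` N" unfolding Q_zero using Nd(1) by simp
    fix a assume "a \<in> ?q ` N"
    then obtain n where n: "n \<in> N" "a = ?q n" by blast
    {
      fix b assume "b \<in> ?q ` N"
      then obtain m where m: "m \<in> N" "b = ?q m" by blast
      show "a \<oplus>\<^bsub>?Q\<^esub> b \<in> ?q ` N"
        unfolding n(2) m(2) q_add[OF Nd(2)[OF n(1)] Nd(2)[OF m(1)]] using Nd(3)[OF n(1) m(1)] by simp
    }
    fix r assume r: "r \<in> carrier R"
    show "r \<odot>\<^bsub>?Q\<^esub> a \<in> ?q ` N"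
      unfolding n(2) q_smult[OF r Nd(2)[OF n(1)]] using Nd(4)[OF r n(1)] by simp
  qed
  have q_x: "?q x \<notin> ?q ` N"
  proof
    assume "?q x \<in> ?q ` N"
    then obtain n where "n \<in> N" "?q x = ?q n" by blast
    then show False using q_eq[OF x(1) Nd(2)] x(2) by blast
  qed
  \<comment> \<open>The class of \<open>x\<close> is outside the image of \<open>N\<close> in
    \<open>M/K\<close>, so double annihilators there give a scalar \<open>t\<close> killing the
    classes of \<open>Y\<close> but not that of \<open>x\<close>.\<close>
  have finite_sol: "\<exists>t\<in>carrier R. (\<forall>n\<in>Y. t \<odot>\<^bsub>M\<^esub> n \<in> K) \<and> t \<odot>\<^bsub>M\<^esub> x \<ominus>\<^bsub>M\<^esub> z \<in> K"
    if Y: "finite Y" "Y \<subseteq> N" for Y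
  proof -
    have "\<exists>t\<in>carrier R. (\<forall>w\<in>?q ` Y. t \<odot>\<^bsub>?Q\<^esub> w = \<zero>\<^bsub>?Q\<^esub>) \<and> t \<odot>\<^bsub>?Q\<^esub> ?q x \<noteq> \<zero>\<^bsub>?Q\<^esub>"
    proof (rule ccontr)
      assume no: "\<not> ?thesis"
      have "?q x \<in> ?q ` N"
      proof (rule Q.double_annihilator[OF finite_imageI[OF Y(1)] qN])
        show YN: "?q ` Y \<subseteq> ?q ` N" using Y(2) by (rule image_mono)
        show "Q.homs_are_smults J w" if w: "w \<in> ?q ` Y" and J: "ideal J R" for w J
        proof (rule Q.all_homs_are_smults[OF artinian_wf[OF Q(2)] noeth q_z socle J])
          show "w \<in> carrier ?Q" using w YN by (intro Q.submoduleD(2)[OF qN]) blast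
        qed
        show "?q x \<in> carrier ?Q" by (rule q_closed[OF x(1)])
        show "t \<odot>\<^bsub>?Q\<^esub> ?q x = \<zero>\<^bsub>?Q\<^esub>"
          if "t \<in> carrier R" "\<forall>w\<in>?q ` Y. t \<odot>\<^bsub>?Q\<^esub> w = \<zero>\<^bsub>?Q\<^esub>" for t
          using no that by blast
      qed
      then show False using q_x by contradiction
    qed
    then obtain t where t: "t \<in> carrier R" "\<And>n. n \<in> Y \<Longrightarrow> t \<odot>\<^bsub>?Q\<^esub> ?q n = \<zero>\<^bsub>?Q\<^esub>"
      "t \<odot>\<^bsub>?Q\<^esub> ?q x \<noteq> \<zero>\<^bsub>?Q\<^esub>" by blast
    \<comment> \<open>The class of \<open>t x\<close> is nonzero, so the socle condition multiplies
      it onto the class of \<open>z\<close>; the solution is \<open>a t\<close>.\<close>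
    obtain a where a: "a \<in> carrier R" "a \<odot>\<^bsub>?Q\<^esub> (t \<odot>\<^bsub>?Q\<^esub> ?q x) = ?q z"
      using socle[OF Q.smult_closed[OF t(1) q_closed[OF x(1)]] t(3)] by blast
    show ?thesis
    proof (intro bexI conjI ballI)
      show at: "a \<otimes> t \<in> carrier R" using a(1) t(1) by simp
      have "?q ((a \<otimes> t) \<odot>\<^bsub>M\<^esub> x) = ?q z"
        using a t(1) q_smult[OF at x(1)] q_closed[OF x(1)] by (simp add: Q.smult_assoc1)
      then show "(a \<otimes> t) \<odot>\<^bsub>M\<^esub> x \<ominus>\<^bsub>M\<^esub> z \<in> K"
        using q_eq[OF smult_closed[OF at x(1)] z(1)] by simp
      fix n assume n: "n \<in> Y"
      then have nM: "n \<in> carrier M" using Y(2) Nd(2) by blast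
      have "?q ((a \<otimes> t) \<odot>\<^bsub>M\<^esub> n) = \<zero>\<^bsub>?Q\<^esub>"
        using a(1) t(1) t(2)[OF n] q_smult[OF at nM] q_closed[OF nM] by (simp add: Q.smult_assoc1)
      then show "(a \<otimes> t) \<odot>\<^bsub>M\<^esub> n \<in> K"
        using q_zero[OF smult_closed[OF at nM]] unfolding Q_zero by simp
    qed
  qed
  \<comment> \<open>All requirements take the form of congruences: \<open>T x z\<close> sends
    \<open>x\<close> to \<open>z\<close> modulo \<open>K\<close>, and \<open>T n 0\<close> sends
    \<open>n\<close> into \<open>K\<close>.\<close>
  define T where "T v w = {t \<in> carrier R. t \<odot>\<^bsub>M\<^esub> v \<ominus>\<^bsub>M\<^esub> w \<in> K}" for v w
  have T_zero: "T v \<zero>\<^bsub>M\<^esub> = {t \<in> carrier R. t \<odot>\<^bsub>M\<^esub> v \<in> K}" if "v \<in> carrier M" for v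
    unfolding T_def using that by (intro Collect_cong conj_cong) (simp_all only: diff_zero smult_closed)
  define \<T> where "\<T> = insert (T x z) ((\<lambda>n. T n \<zero>\<^bsub>M\<^esub>) ` N)"
  have aff: "affine U" if "U \<in> \<T>" for U
    using that unfolding \<T>_def T_def by (auto intro: affine_smult_fibre x(1) K z(1) Nd(2))
  have fip: "carrier R \<inter> \<Inter>F \<noteq> {}" if F: "finite F" "F \<subseteq> \<T>" for F
  proof -
    \<comment> \<open>The set \<open>T x z\<close> is split off so that the rest of \<open>F\<close>
      comes from a finite subset \<open>Y\<close> of \<open>N\<close>, where
      \<open>finite_sol\<close> applies.\<close>
    have "finite (F - {T x z})" "F - {T x z} \<subseteq> (\<lambda>n. T n \<zero>\<^bsub>M\<^esub>) ` N"
      using F unfolding \<T>_def by auto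
    then obtain Y where Y: "Y \<subseteq> N" "finite Y" "F - {T x z} = (\<lambda>n. T n \<zero>\<^bsub>M\<^esub>) ` Y"
      using finite_subset_image[of "F - {T x z}" "\<lambda>n. T n \<zero>\<^bsub>M\<^esub>" N] by blast
    obtain t where t: "t \<in> carrier R" "\<And>n. n \<in> Y \<Longrightarrow> t \<odot>\<^bsub>M\<^esub> n \<in> K" "t \<odot>\<^bsub>M\<^esub> x \<ominus>\<^bsub>M\<^esub> z \<in> K"
      using finite_sol[OF Y(2,1)] by blast
    have "t \<in> U" if U: "U \<in> F" for U
    proof (cases "U = T x z")
      case True
      then show ?thesis unfolding T_def using t(1,3) by simp
    next
      case False
      then have "U \<in> (\<lambda>n. T n \<zero>\<^bsub>M\<^esub>) ` Y" using U Y(3) by blast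
      then obtain n where n: "n \<in> Y" "U = T n \<zero>\<^bsub>M\<^esub>" by blast
      then have "n \<in> carrier M" using Y(1) Nd(2) by blast
      then show ?thesis unfolding n(2) using T_zero t(1) t(2)[OF n(1)] by simp
    qed
    then have "t \<in> carrier R \<inter> \<Inter>F" using t(1) by simp
    then show ?thesis by blast
  qed
  obtain s where "\<forall>Y F. finite Y \<longrightarrow> Y \<subseteq> carrier M \<longrightarrow> finite F \<longrightarrow> F \<subseteq> \<T> \<longrightarrow>
      (\<exists>t\<in>carrier R \<inter> \<Inter>F. \<forall>y\<in>Y. s y = t \<odot>\<^bsub>M\<^esub> y)"
    by (rule locally_scalar_map[OF artinian_wf[OF art] aff fip])
  note s = this[rule_format]
  show thesis
  proof (rule that[of s])
    show "locally_scalar s" unfolding locally_scalar_def using s[of _ "{}"] by simp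
  next
    fix n assume n: "n \<in> N"
    obtain t where t: "t \<in> T n \<zero>\<^bsub>M\<^esub>" "s n = t \<odot>\<^bsub>M\<^esub> n"
      using s[of "{n}" "{T n \<zero>\<^bsub>M\<^esub>}"] Nd(2)[OF n] n unfolding \<T>_def by auto
    then show "s n \<in> K" using T_zero[OF Nd(2)[OF n]] by simp
  next
    obtain t where t: "t \<in> T x z" "s x = t \<odot>\<^bsub>M\<^esub> x"
      using s[of "{x}" "{T x z}"] x(1) unfolding \<T>_def by auto
    then show "s x \<ominus>\<^bsub>M\<^esub> z \<in> K" unfolding T_def by simp
  qed
qed

text \<open>Each claim concerns finitely many elements at a time, on which \<open>s\<close> is
  multiplication by a single scalar.\<close>

lemma locally_scalar_linear:
  assumes "locally_scalar s"
  shows "\<And>x y. x \<in> carrier M \<Longrightarrow> y \<in> carrier M \<Longrightarrow> s (x \<oplus>\<^bsub>M\<^esub> y) = s x \<oplus>\<^bsub>M\<^esub> s y"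
    and "\<And>r x. r \<in> carrier R \<Longrightarrow> x \<in> carrier M \<Longrightarrow> s (r \<odot>\<^bsub>M\<^esub> x) = r \<odot>\<^bsub>M\<^esub> s x"
    and "\<And>x A. submodule A R M \<Longrightarrow> x \<in> A \<Longrightarrow> s x \<in> A"
proof -
  note s = assms[unfolded locally_scalar_def, rule_format]
  show "s (x \<oplus>\<^bsub>M\<^esub> y) = s x \<oplus>\<^bsub>M\<^esub> s y" if "x \<in> carrier M" "y \<in> carrier M" for x y
    using s[of "{x, y, x \<oplus>\<^bsub>M\<^esub> y}"] that by (auto simp: smult_r_distr)
  show "s (r \<odot>\<^bsub>M\<^esub> x) = r \<odot>\<^bsub>M\<^esub> s x" if r: "r \<in> carrier R" "x \<in> carrier M" for r x
  proof -
    obtain t where "t \<in> carrier R" "s x = t \<odot>\<^bsub>M\<^esub> x" "s (r \<odot>\<^bsub>M\<^esub> x) = t \<odot>\<^bsub>M\<^esub> (r \<odot>\<^bsub>M\<^esub> x)"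
      using s[of "{x, r \<odot>\<^bsub>M\<^esub> x}"] r by auto
    then show ?thesis using r by (simp add: smult_assoc1[symmetric] R.m_comm)
  qed
  show "s x \<in> A" if A: "submodule A R M" "x \<in> A" for x A
  proof -
    obtain t where "t \<in> carrier R" "s x = t \<odot>\<^bsub>M\<^esub> x" using s[of "{x}"] submoduleD(2)[OF A] by auto
    then show ?thesis using submoduleD(4)[OF A(1) _ A(2)] by simp
  qed
qed

section \<open>Induction over the submodules of an object\<close>

text \<open>For nonzero \<open>N\<close>, the smaller \<open>N0\<close> is in \<open>C\<close> by
  \<open>proper\<close>. It remains to find \<open>N/N0\<close> in \<open>C\<close>, as a cokernel
  of a map between submodules in \<open>C\<close>; then \<open>N\<close> is an extension of
  \<open>N/N0\<close> by \<open>N0\<close>.\<close>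

lemma inC_step:
  assumes noeth: "noetherian_ring R" and M: "inC (carrier M)" and N: "submodule N R M"
    and proper: "\<And>L. submodule L R M \<Longrightarrow> L \<subset> N \<Longrightarrow> inC L"
  shows "inC N"
proof (cases "N = {\<zero>\<^bsub>M\<^esub>}")
  case True
  then show ?thesis using inC_zero[OF M] by simp
next
  case False
  note Nd = submoduleD[OF N]
  obtain z where z: "z \<in> N" "z \<noteq> \<zero>\<^bsub>M\<^esub>" using False Nd(1) by blast
  have NM: "N \<subseteq> carrier M" using Nd(2) by (rule subsetI)
  obtain M0 where M0: "inC M0" "N \<subseteq> M0"
    and min: "\<And>A. inC A \<Longrightarrow> N \<subseteq> A \<Longrightarrow> A \<subseteq> M0 \<Longrightarrow> A = M0"
    using minimal_inC_over[OF M NM] by blast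
  have M0s: "submodule M0 R M" using M0(1) unfolding inC_def by simp
  note M0d = submoduleD[OF M0s]
  obtain K where K: "submodule K R M" "z \<notin> K"
    and essential: "\<And>v. v \<in> carrier M \<Longrightarrow> v \<notin> K \<Longrightarrow> \<exists>a\<in>carrier R. a \<odot>\<^bsub>M\<^esub> v \<ominus>\<^bsub>M\<^esub> z \<in> K"
    using maximal_submodule_avoiding[OF z(2) Nd(2)[OF z(1)]] by blast
  note Kd = submoduleD[OF K(1)]
  define N0 where "N0 = K \<inter> N"
  have N0: "submodule N0 R M" unfolding N0_def by (rule submodule_Int[OF K(1) N])
  have "N0 \<subset> N" unfolding N0_def using z(1) K(2) by blast
  then have N0C: "inC N0" by (rule proper[OF N0])
  have N0M0: "N0 \<subseteq> M0" using \<open>N0 \<subset> N\<close> M0(2) by blast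
  note N0d = submoduleD[OF N0]
  \<comment> \<open>This is \<open>M0 = N + (K \<inter> M0)\<close>. It makes \<open>M0/N0\<close>
    the direct sum of \<open>N/N0\<close> and \<open>(K \<inter> M0)/N0\<close>, as \<open>N\<close>
    meets \<open>K\<close> in \<open>N0\<close>.\<close>
  have decomp: "\<exists>n\<in>N. x \<ominus>\<^bsub>M\<^esub> n \<in> K" if x: "x \<in> M0" for x
  proof (rule ccontr)
    assume no: "\<not> ?thesis"
    have xM: "x \<in> carrier M" by (rule M0d(2)[OF x])
    obtain s where s: "locally_scalar s"
      and sN: "\<And>n. n \<in> N \<Longrightarrow> s n \<in> K" and sx: "s x \<ominus>\<^bsub>M\<^esub> z \<in> K"
      using separating_locally_scalar_map[OF noeth N K(1) Nd(2)[OF z(1)] K(2) essential xM] no by blast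
    note lin = locally_scalar_linear[OF s]
    define D where "D = {y \<in> M0. s y \<in> N0}"
    have sM: "s y \<in> carrier M" if "y \<in> M0" for y using lin(3)[OF M0s that] by (rule M0d(2))
    have "submodule D R M"
    proof (rule submoduleI')
      show "D \<subseteq> carrier M" unfolding D_def using M0d(2) by blast
      show "\<zero>\<^bsub>M\<^esub> \<in> D" unfolding D_def using M0d(1) lin(3)[OF N0 N0d(1)] by simp
    qed (simp_all add: D_def M0d N0d lin)
    then have "inC D"
    proof (rule kernel_inC[OF M0(1) N0C N0M0 _ D_def])
      show "s y \<in> M0" if "y \<in> M0" for y by (rule lin(3)[OF M0s that])
      show "s (u \<oplus>\<^bsub>M\<^esub> v) \<ominus>\<^bsub>M\<^esub> (s u \<oplus>\<^bsub>M\<^esub> s v) \<in> N0" if "u \<in> M0" "v \<in> M0" for u v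
        using lin(1)[OF M0d(2)[OF that(1)] M0d(2)[OF that(2)]] sM[OF that(1)] sM[OF that(2)] N0d(1)
        by (simp add: a_minus_def M.r_neg)
      show "s (r \<odot>\<^bsub>M\<^esub> v) \<ominus>\<^bsub>M\<^esub> r \<odot>\<^bsub>M\<^esub> s v \<in> N0" if "r \<in> carrier R" "v \<in> M0" for r v
        using lin(2)[OF that(1) M0d(2)[OF that(2)]] sM[OF that(2)] that(1) N0d(1)
        by (simp add: a_minus_def M.r_neg)
    qed
    moreover have "N \<subseteq> D" unfolding D_def N0_def using sN lin(3)[OF N] M0(2) by blast
    \<comment> \<open>Minimality of \<open>M0\<close> forces \<open>s\<close> to map all of
      \<open>M0\<close>, and in particular \<open>x\<close>, into \<open>N0\<close>, hence into
      \<open>K\<close>; but \<open>s x\<close> is congruent to \<open>z\<close> modulo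
      \<open>K\<close>.\<close>
    ultimately have "D = M0" by (rule min) (auto simp: D_def)
    then have sxK: "s x \<in> K" using x unfolding D_def N0_def by blast
    have "s x \<ominus>\<^bsub>M\<^esub> (s x \<ominus>\<^bsub>M\<^esub> z) \<in> K" by (rule Kd(6)[OF sxK sx])
    then have "z \<in> K"
      using sM[OF x] Nd(2)[OF z(1)] by (simp add: a_minus_def M.minus_add M.r_neg2)
    then show False using K(2) by contradiction
  qed
  \<comment> \<open>A chosen component in \<open>N\<close>. It is determined only modulo
    \<open>N0\<close>, so \<open>g\<close> represents the projection of \<open>M0\<close> onto
    \<open>N/N0\<close>.\<close>
  define g where "g x = (SOME n. n \<in> N \<and> x \<ominus>\<^bsub>M\<^esub> n \<in> K)" for x
  have g: "g x \<in> N" "x \<ominus>\<^bsub>M\<^esub> g x \<in> K" if "x \<in> M0" for x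
    unfolding g_def using someI_ex[OF decomp[OF that, unfolded Bex_def]] by simp_all
  have gM: "g x \<in> carrier M" if "x \<in> M0" for x using g(1)[OF that] by (rule Nd(2))
  define L where "L = K \<inter> M0"
  have L: "submodule L R M" unfolding L_def by (rule submodule_Int[OF K(1) M0s])
  have L_eq: "L = {x \<in> M0. g x \<in> N0}"
  proof -
    have "x \<in> K \<longleftrightarrow> g x \<in> N0" if x: "x \<in> M0" for x
    proof
      assume "x \<in> K"
      then have "x \<ominus>\<^bsub>M\<^esub> (x \<ominus>\<^bsub>M\<^esub> g x) \<in> K" by (rule Kd(6)[OF _ g(2)[OF x]])
      then show "g x \<in> N0" using g(1)[OF x] gM[OF x] M0d(2)[OF x]
        unfolding N0_def by (simp add: a_minus_def M.minus_add M.r_neg2)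
    next
      assume "g x \<in> N0"
      then have "(x \<ominus>\<^bsub>M\<^esub> g x) \<oplus>\<^bsub>M\<^esub> g x \<in> K" using Kd(3)[OF g(2)[OF x]] unfolding N0_def by blast
      then show "x \<in> K" using gM[OF x] M0d(2)[OF x] by (simp add: a_minus_def M.a_assoc M.l_neg)
    qed
    then show ?thesis unfolding L_def by blast
  qed
  \<comment> \<open>The defect is a combination of elements of \<open>N\<close> and also of the
    differences \<open>x - g x\<close> in \<open>K\<close>, so it lies in \<open>N0\<close>. The
    same argument gives \<open>g_smult\<close>.\<close>
  have g_add: "g (x \<oplus>\<^bsub>M\<^esub> y) \<ominus>\<^bsub>M\<^esub> (g x \<oplus>\<^bsub>M\<^esub> g y) \<in> N0" if x: "x \<in> M0" and y: "y \<in> M0" for x y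
  proof -
    note xy = M0d(3)[OF x y]
    have "((x \<ominus>\<^bsub>M\<^esub> g x) \<oplus>\<^bsub>M\<^esub> (y \<ominus>\<^bsub>M\<^esub> g y)) \<ominus>\<^bsub>M\<^esub> (x \<oplus>\<^bsub>M\<^esub> y \<ominus>\<^bsub>M\<^esub> g (x \<oplus>\<^bsub>M\<^esub> y)) \<in> K"
      by (intro Kd(6) Kd(3) g(2) x y xy)
    also have "((x \<ominus>\<^bsub>M\<^esub> g x) \<oplus>\<^bsub>M\<^esub> (y \<ominus>\<^bsub>M\<^esub> g y)) \<ominus>\<^bsub>M\<^esub> (x \<oplus>\<^bsub>M\<^esub> y \<ominus>\<^bsub>M\<^esub> g (x \<oplus>\<^bsub>M\<^esub> y)) =
       g (x \<oplus>\<^bsub>M\<^esub> y) \<ominus>\<^bsub>M\<^esub> (g x \<oplus>\<^bsub>M\<^esub> g y)"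
      using gM[OF x] gM[OF y] gM[OF xy] M0d(2)[OF x] M0d(2)[OF y]
      by (simp add: a_minus_def M.minus_add M.a_ac M.r_neg1 M.r_neg2 M.r_neg)
    finally show ?thesis unfolding N0_def using g(1)[OF x] g(1)[OF y] g(1)[OF xy] Nd(3,6) by blast
  qed
  have g_smult: "g (r \<odot>\<^bsub>M\<^esub> x) \<ominus>\<^bsub>M\<^esub> r \<odot>\<^bsub>M\<^esub> g x \<in> N0" if r: "r \<in> carrier R" and x: "x \<in> M0" for r x
  proof -
    note rx = M0d(4)[OF r x]
    have "r \<odot>\<^bsub>M\<^esub> (x \<ominus>\<^bsub>M\<^esub> g x) \<ominus>\<^bsub>M\<^esub> (r \<odot>\<^bsub>M\<^esub> x \<ominus>\<^bsub>M\<^esub> g (r \<odot>\<^bsub>M\<^esub> x)) \<in> K"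
      by (intro Kd(6) Kd(4) g(2) r x rx)
    also have "r \<odot>\<^bsub>M\<^esub> (x \<ominus>\<^bsub>M\<^esub> g x) \<ominus>\<^bsub>M\<^esub> (r \<odot>\<^bsub>M\<^esub> x \<ominus>\<^bsub>M\<^esub> g (r \<odot>\<^bsub>M\<^esub> x)) = g (r \<odot>\<^bsub>M\<^esub> x) \<ominus>\<^bsub>M\<^esub> r \<odot>\<^bsub>M\<^esub> g x"
      using gM[OF x] gM[OF rx] M0d(2)[OF x] r
      by (simp add: a_minus_def smult_r_distr smult_r_minus M.minus_add M.a_ac M.r_neg1 M.r_neg2 M.r_neg)
    finally show ?thesis unfolding N0_def using g(1)[OF x] g(1)[OF rx] r Nd(4,6) by blast
  qed
  \<comment> \<open>The projection is viewed here as a map from \<open>M0\<close> to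
    \<open>M0/N0\<close>, whose source and target are both in \<open>C\<close>; its kernel is
    \<open>L\<close>.\<close>
  have LC: "inC L"
    by (rule kernel_inC[OF M0(1) N0C N0M0 L L_eq _ g_add g_smult]) (use g(1) M0(2) in blast)
  \<comment> \<open>The same projection, now with target \<open>N/N0\<close>, is a cokernel of the
    inclusion of \<open>L\<close> into \<open>M0\<close>.\<close>
  let ?Q = "quot_module M N N0" and ?p = "\<lambda>x. coset_rep M N0 (g x)"
  have "?p \<in> mod_hom R (sub M0) ?Q"
    unfolding mod_hom_iff
  proof (intro conjI ballI)
    fix x assume "x \<in> carrier (sub M0)"
    then have x: "x \<in> M0" by simp
    then show "?p x \<in> carrier ?Q" using g(1) by (simp add: quot_module_def)
    {
      fix y assume "y \<in> carrier (sub M0)"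
      then have y: "y \<in> M0" by simp
      have "?p (x \<oplus>\<^bsub>M\<^esub> y) = coset_rep M N0 (g x \<oplus>\<^bsub>M\<^esub> g y)"
        using g_add[OF x y] gM x y M0d(3)
          coset_rep_eq_iff[OF N0, of "g (x \<oplus>\<^bsub>M\<^esub> y)" "g x \<oplus>\<^bsub>M\<^esub> g y"] by simp
      then show "?p (x \<oplus>\<^bsub>sub M0\<^esub> y) = ?p x \<oplus>\<^bsub>?Q\<^esub> ?p y"
        using coset_rep_add[OF N0, of "g x" "g y"] gM x y by (simp add: quot_module_def)
    }
    fix r assume r: "r \<in> carrier R"
    have "?p (r \<odot>\<^bsub>M\<^esub> x) = coset_rep M N0 (r \<odot>\<^bsub>M\<^esub> g x)"
      using g_smult[OF r x] gM x r M0d(4)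
        coset_rep_eq_iff[OF N0, of "g (r \<odot>\<^bsub>M\<^esub> x)" "r \<odot>\<^bsub>M\<^esub> g x"] by simp
    then show "?p (r \<odot>\<^bsub>sub M0\<^esub> x) = r \<odot>\<^bsub>?Q\<^esub> ?p x"
      using coset_rep_smult[OF N0 r, of "g x"] gM x by (simp add: quot_module_def)
  qed
  moreover have "?p ` carrier (sub M0) = carrier ?Q"
  proof
    show "?p ` carrier (sub M0) \<subseteq> carrier ?Q" using g(1) by (auto simp: quot_module_def)
    show "carrier ?Q \<subseteq> ?p ` carrier (sub M0)"
    proof
      fix u assume "u \<in> carrier ?Q"
      then obtain n where n: "n \<in> N" "u = coset_rep M N0 n" by (auto simp: quot_module_def)
      then have nM0: "n \<in> M0" using M0(2) by blast
      \<comment> \<open>On \<open>N\<close> the map \<open>g\<close> is the identity modulo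
        \<open>N0\<close>, which gives surjectivity.\<close>
      have "n \<ominus>\<^bsub>M\<^esub> g n \<in> N0"
        unfolding N0_def using g[OF nM0] Nd(6)[OF n(1)] by blast
      then have "u = ?p n" unfolding n(2) using coset_rep_eq_iff[OF N0 Nd(2)[OF n(1)] gM[OF nM0]] by simp
      then show "u \<in> ?p ` carrier (sub M0)" using nM0 by simp
    qed
  qed
  moreover have "mod_kernel (sub M0) ?Q ?p = id ` carrier (sub L)"
    unfolding mod_kernel_eq using L_eq coset_rep_zero_iff[OF N0 gM] by (auto simp: quot_module_def)
  ultimately have "is_cokernel R (sub L) (sub M0) id ?Q ?p"
    unfolding is_cokernel_def by blast
  moreover have "id \<in> mod_hom R (sub L) (sub M0)" unfolding mod_hom_iff L_def by auto
  moreover have "?Q \<in> Art R" unfolding Art_def using quot_module(2)[OF N0 N] by simp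
  moreover have "sub L \<in> C" "sub M0 \<in> C" using LC M0(1) unfolding inC_def by simp_all
  ultimately have "?Q \<in> C"
    using wide unfolding wide_subcategory_def closed_under_cokernels_def by blast
  then show ?thesis using extension_inC[OF N N0C] \<open>N0 \<subset> N\<close> by blast
qed

text \<open>The descending chain condition makes the inclusion order on submodules well-founded, so
  \<open>inC_step\<close> can assume the claim for all proper submodules of
  \<open>N\<close>.\<close>

lemma all_submodules_inC:
  assumes "noetherian_ring R" "inC (carrier M)" "submodule N R M"
  shows "inC N"
proof -
  have "submodule N R M \<longrightarrow> inC N"
  proof (induction N rule: wf_induct_rule[OF artinian_wf[OF art]])
    case (1 N)
    then show ?case using inC_step[OF assms(1,2), of N] by blast
  qed
  then show ?thesis using assms(3) by simp
qed

end

section \<open>From submodules to arbitrary subobjects\<close>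

lemma mod_hom_image_submodule:
  assumes "module R N" "module R M" "f \<in> mod_hom R N M"
  shows "submodule (f ` carrier N) R M"
proof -
  interpret N: module R N by fact
  interpret M: module R M by fact
  note f = assms(3)[unfolded mod_hom_iff]
  have "f \<zero>\<^bsub>N\<^esub> \<oplus>\<^bsub>M\<^esub> f \<zero>\<^bsub>N\<^esub> = f \<zero>\<^bsub>N\<^esub>"
    using f N.zero_closed by (metis N.r_zero)
  then have zero: "f \<zero>\<^bsub>N\<^esub> = \<zero>\<^bsub>M\<^esub>"
    using f N.zero_closed M.add.r_cancel_one by blast
  show ?thesis
  proof (rule M.submoduleI')
    show "f ` carrier N \<subseteq> carrier M" using f by blast
    show "\<zero>\<^bsub>M\<^esub> \<in> f ` carrier N" using zero[symmetric] N.zero_closed by (rule image_eqI)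
    fix a assume "a \<in> f ` carrier N"
    then obtain x where x: "x \<in> carrier N" "a = f x" by blast
    {
      fix b assume "b \<in> f ` carrier N"
      then obtain y where y: "y \<in> carrier N" "b = f y" by blast
      have "a \<oplus>\<^bsub>M\<^esub> b = f (x \<oplus>\<^bsub>N\<^esub> y)" using x y f by simp
      then show "a \<oplus>\<^bsub>M\<^esub> b \<in> f ` carrier N" using x(1) y(1) by simp
    }
    fix r assume r: "r \<in> carrier R"
    have "r \<odot>\<^bsub>M\<^esub> a = f (r \<odot>\<^bsub>N\<^esub> x)" using x r f by simp
    then show "r \<odot>\<^bsub>M\<^esub> a \<in> f ` carrier N" using x(1) r by simp
  qed
qed

theorem theorem1p3:
  fixes R :: "('a, 'm) ring_scheme"
    and C :: "('a, 'b) module set"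
  assumes "cring R"
    and "noetherian_ring R"
    and "infinite (UNIV :: 'b set)"
    and "wide_subcategory R C"
  shows "Serre_subcategory R C"
  unfolding Serre_subcategory_def closed_under_subobjects_def
proof (intro conjI ballI impI assms(4))
  fix M N :: "('a, 'b) module" and i
  assume M: "M \<in> C" and N: "N \<in> Art R" and i: "i \<in> mod_hom R N M" "inj_on i (carrier N)"
  have "artinian_module R M"
    using M assms(4) unfolding wide_subcategory_def subcategory_def Art_def by blast
  moreover from this have "module R M" unfolding artinian_module_def by simp
  ultimately interpret wide_in_artinian R M C
    using assms(4) by (simp add: wide_in_artinian_def artinian_def artinian_axioms_def wide_in_artinian_axioms_def)
  have N_mod: "module R N" using N unfolding Art_def artinian_module_def by simp
  have sub: "submodule (i ` carrier N) R M"
    by (rule mod_hom_image_submodule[OF N_mod module_axioms i(1)])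
  have MC: "inC (carrier M)" unfolding inC_def using M carrier_is_submodule by simp
  have imC: "inC (i ` carrier N)" by (rule all_submodules_inC[OF assms(2) MC sub])
  \<comment> \<open>The image of \<open>i\<close> is in \<open>C\<close>, hence so is its quotient
    in \<open>M\<close>. The kernel of \<open>?p\<close> is that image, and \<open>i\<close> itself
    exhibits \<open>N\<close> as this kernel.\<close>
  let ?Q = "quot_module M (carrier M) (i ` carrier N)" and ?p = "coset_rep M (i ` carrier N)"
  have im: "i ` carrier N \<subseteq> carrier M" using submoduleD(2)[OF sub] by (rule subsetI)
  have "?p \<in> mod_hom R M ?Q" using quot_module(3)[OF sub carrier_is_submodule] by simp
  moreover have "is_kernel R M ?Q ?p N i"
    unfolding is_kernel_def mod_kernel_eq using i im coset_rep_zero_iff[OF sub]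
    by (auto simp: quot_module_def)
  ultimately show "N \<in> C"
    using assms(4) M quot_in_C[OF MC imC im] N
    unfolding wide_subcategory_def closed_under_kernels_def by blast
qed

end
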